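(* Consider the affine-in-control switched system $$\dot x=f_\sigma(x)+\sum_{j=1}^m g_{\sigma,j}(x)u_j,\qquad (x(0),\sigma(0))=(x_0,\sigma_0),\quad t\ge0,$$ with controls $u=[u_1,\dots,u_m]^{\mathrm T}$ taking values in $\mathcal U=\mathbb{R}^m$. Suppose that $\sigma$ belongs to class EH with parameters $\lambda>0$ and $q_i\in[0,1]$, $i\in\mathcal P$, and that there exists a family $\{V_i\}_{i\in\mathcal P}$ of twice continuously differentiable real-valued functions on $\mathbb{R}^n$ such that: (i) there are $\alpha_1,\alpha_2\in\mathcal K_\infty$ and $\mu>1$ with $\alpha_1(\|x\|)\le V_i(x)\le\alpha_2(\|x\|)$ and $V_i(x)\le\mu V_j(x)$ for all $x\in\mathbb{R}^n$, $i,j\in\mathcal P$; (ii) there exist a control function $\overline k=[\overline k_1,\dots,\overline k_m]^{\mathrm T}:\mathbb{R}^n\to\mathcal U$, for which the closed-loop vector fields $f_i+\sum_{j=1}^m g_{i,j}\overline k_j$, $i\in\mathcal P$, are locally Lipschitz, and numbers $\{\lambda_i\}_{i\in\mathcal P}\subset\mathbb{R}$ such that for every $i\in\mathcal P$ and $x\in\mathbb{R}^n$, $$\Big\langle\nabla V_i(x),\,f_i(x)+\sum_{j=1}^m g_{i,j}(x)\overline k_j(x)\Big\rangle\le-\lambda_iV_i(x);$$ (iii) $\lambda_i+\lambda>0$ for all $i\in\mathcal P$, and $\displaystyle\sum_{i\in\mathcal P}\frac{\mu q_i}{1+\lambda_i/\lambda}<1$. Then $\overline k$ renders the system globally asymptotically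 stable almost surely in closed loop, i.e. the closed-loop system $$\dot x=f_\sigma(x)+\sum_{j=1}^m g_{\sigma,j}(x)\overline k_j(x),\qquad (x(0),\sigma(0))=(x_0,\sigma_0),\quad t\ge0,$$ is globally asymptotically stable almost surely.
   Context: Notation: $\mathbb{N}=\{1,2,\dots\}$, $\mathbb{N}_0=\mathbb{N}\cup\{0\}$, $\|\cdot\|$ is the Euclidean norm. A function $\alpha:[0,\infty[\to[0,\infty[$ is of class $\mathcal K$ if it is continuous, strictly increasing and $\alpha(0)=0$; it is of class $\mathcal K_\infty$ if in addition it is unbounded. Setting: $\mathcal P=\{1,\dots,\mathrm N\}$ is a finite index set; $f_i$ and $g_{i,j}$ are twice continuously differentiable vector fields on $\mathbb{R}^n$ with $f_i(0)=0$, $g_{i,j}(0)=0$ for each $i\in\mathcal P$, $j\in\{1,\dots,m\}$. On a complete probability space $(\Omega,\mathfrak F,\mathsf P)$, the switching signal $\sigma=(\sigma(t))_{t\ge0}$ is a càdlàg $\mathcal P$-valued process with $\sigma(0)=\sigma_0$ deterministic. Its switching instants are $0=\tau_0<\tau_1<\tau_2<\cdots$ (almost surely); $\sigma$ is constant on each $[\tau_i,\tau_{i+1}[$, and $\sigma(\tau_i)=\sigma(\tau_{i-1})$ is allowed. The holding times are $S_i:=\tau_i-\tau_{i-1}$, $i\in\mathbb{N}$. The state $x$ does not jump at switching instants, and $x(\cdot)$ denotes the (pathwise, Carathéodory, absolutely continuous) solution of the closed-loop system for the initial state $x_0$; it depends on $x_0$ and $\omega\in\Omega$. Class EH: $\sigma$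 belongs to class EH if (EH1) $(S_i)_{i\in\mathbb{N}}$ is i.i.d., each $S_i$ exponential with parameter $\lambda>0$, i.e. $\mathsf P(S_i\le s)=1-e^{-\lambda s}$ for $s\ge0$; (EH2) there exist $q_i\in[0,1]$, $i\in\mathcal P$, such that for all $j\in\mathbb{N}$, $\mathsf P\big(\sigma(\tau_j)=i\,\big|\,(\sigma(\tau_k))_{k=0}^{j-1}\big)=q_i$; (EH3) the sequences $(S_i)_{i\in\mathbb{N}}$ and $(\sigma(\tau_i))_{i\in\mathbb{N}_0}$ are mutually independent. Global asymptotic stability almost surely means: (AS1) with probability one, for every $\varepsilon>0$ there is $\delta>0$ such that for every $x_0$, $\|x_0\|<\delta$ implies $\sup_{t\ge0}\|x(t)\|<\varepsilon$; and (AS2) with probability one, for all $r,\varepsilon'>0$ there is $T\ge0$ such that for every $x_0$, $\|x_0\|<r$ implies $\sup_{t\ge T}\|x(t)\|<\varepsilon'$. ($\delta$ and $T$ may depend on $\omega$.) *)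

theory Defs
  imports "HOL-Probability.Probability"
begin

section \<open>Functions and vector fields\<close>

definition class_K :: "(real \<Rightarrow> real) \<Rightarrow> bool" where
  "class_K \<alpha> \<longleftrightarrow>
     \<alpha> ` {0..} \<subseteq> {0..} \<and> continuous_on {0..} \<alpha> \<and> strict_mono_on {0..} \<alpha> \<and> \<alpha> 0 = 0"

definition class_K_infinity :: "(real \<Rightarrow> real) \<Rightarrow> bool" where
  "class_K_infinity \<alpha> \<longleftrightarrow> class_K \<alpha> \<and> \<not> bounded (\<alpha> ` {0..})"

definition twice_continuously_differentiable ::
    "('a::real_normed_vector \<Rightarrow> 'b::real_normed_vector) \<Rightarrow> bool" where
  "twice_continuously_differentiable h \<longleftrightarrow>
     (\<exists>(h' :: 'a \<Rightarrow> 'a \<Rightarrow>\<^sub>L 'b) (h'' :: 'a \<Rightarrow> 'a \<Rightarrow>\<^sub>L ('a \<Rightarrow>\<^sub>L 'b)).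
        (\<forall>x. (h has_derivative blinfun_apply (h' x)) (at x)) \<and>
        (\<forall>x. (h' has_derivative blinfun_apply (h'' x)) (at x)) \<and>
        continuous_on UNIV h'')"

definition gradient :: "('a::real_inner \<Rightarrow> real) \<Rightarrow> 'a \<Rightarrow> 'a" where
  "gradient V x = (THE D. GDERIV V x :> D)"

(* The time argument of the library's local_lipschitz is a dummy here. *)
definition locally_Lipschitz :: "('a::metric_space \<Rightarrow> 'b::metric_space) \<Rightarrow> bool" where
  "locally_Lipschitz h \<longleftrightarrow> local_lipschitz (UNIV :: real set) UNIV (\<lambda>_. h)"

definition affine_control_field ::
    "('i \<Rightarrow> 'a::real_vector \<Rightarrow> 'a) \<Rightarrow> ('i \<Rightarrow> 'm::finite \<Rightarrow> 'a \<Rightarrow> 'a) \<Rightarrow> 'i \<Rightarrow> 'a \<Rightarrow> real ^ 'm \<Rightarrow> 'a" where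
  "affine_control_field f g i x u = f i x + (\<Sum>j\<in>UNIV. (u $ j) *\<^sub>R g i j x)"

definition closed_loop_field ::
    "('i \<Rightarrow> 'a::real_vector \<Rightarrow> 'a) \<Rightarrow> ('i \<Rightarrow> 'm::finite \<Rightarrow> 'a \<Rightarrow> 'a) \<Rightarrow> ('a \<Rightarrow> real ^ 'm) \<Rightarrow> 'i \<Rightarrow> 'a \<Rightarrow> 'a" where
  "closed_loop_field f g k i x = affine_control_field f g i x (k x)"

section \<open>Caratheodory solutions\<close>

definition absolutely_continuous_on_interval :: "real \<Rightarrow> real \<Rightarrow> (real \<Rightarrow> 'a::real_normed_vector) \<Rightarrow> bool" where
  "absolutely_continuous_on_interval a b x \<longleftrightarrow>
     (\<forall>\<epsilon>>0. \<exists>\<delta>>0. \<forall>(n::nat) (u::nat \<Rightarrow> real) (v::nat \<Rightarrow> real).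
        (\<forall>k<n. a \<le> u k \<and> u k \<le> v k \<and> v k \<le> b) \<and>
        disjoint_family_on (\<lambda>k. {u k<..<v k}) {..<n} \<and>
        (\<Sum>k<n. v k - u k) < \<delta> \<longrightarrow>
        (\<Sum>k<n. norm (x (v k) - x (u k))) < \<epsilon>)"

(* A solution on the whole of [0,oo) of x' = F (s t) x, x(0) = x0. The values of x at negative
   times are irrelevant. *)
definition caratheodory_solution ::
    "('i \<Rightarrow> 'a::real_normed_vector \<Rightarrow> 'a) \<Rightarrow> (real \<Rightarrow> 'i) \<Rightarrow> 'a \<Rightarrow> (real \<Rightarrow> 'a) \<Rightarrow> bool" where
  "caratheodory_solution F s x0 x \<longleftrightarrow>
     x 0 = x0 \<and>
     (\<forall>T\<ge>0. absolutely_continuous_on_interval 0 T x) \<and>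
     (AE t in lborel. 0 \<le> t \<longrightarrow> (x has_vector_derivative F (s t) (x t)) (at t within {0..}))"

section \<open>Random switching signals\<close>

(* Limits refer to the discrete topology on nat. *)
definition cadlag :: "(real \<Rightarrow> nat) \<Rightarrow> bool" where
  "cadlag s \<longleftrightarrow>
     (\<forall>t\<ge>0. (s \<longlongrightarrow> s t) (at_right t)) \<and> (\<forall>t>0. \<exists>l. (s \<longlongrightarrow> l) (at_left t))"

(* The switching instants tau are part of the data: they are not determined by sigma, because
   sigma need not change its value at a switching instant. *)
definition switching_signal ::
    "'w measure \<Rightarrow> nat set \<Rightarrow> nat \<Rightarrow> (real \<Rightarrow> 'w \<Rightarrow> nat) \<Rightarrow> (nat \<Rightarrow> 'w \<Rightarrow> real) \<Rightarrow> bool" where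
  "switching_signal M P \<sigma>\<^sub>0 \<sigma> \<tau> \<longleftrightarrow>
     (\<forall>t\<ge>0. \<sigma> t \<in> measurable M (count_space P)) \<and>
     (\<forall>\<omega>\<in>space M. \<sigma> 0 \<omega> = \<sigma>\<^sub>0) \<and>
     (\<forall>\<omega>\<in>space M. cadlag (\<lambda>t. \<sigma> t \<omega>)) \<and>
     (\<forall>i. \<tau> i \<in> borel_measurable M) \<and>
     (AE \<omega> in M. \<tau> 0 \<omega> = 0 \<and> (\<forall>i. \<tau> i \<omega> < \<tau> (Suc i) \<omega>)) \<and>
     (AE \<omega> in M. \<forall>i. \<forall>t\<in>{\<tau> i \<omega>..<\<tau> (Suc i) \<omega>}. \<sigma> t \<omega> = \<sigma> (\<tau> i \<omega>) \<omega>)"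

definition holding_time :: "(nat \<Rightarrow> 'w \<Rightarrow> real) \<Rightarrow> nat \<Rightarrow> 'w \<Rightarrow> real" where
  "holding_time \<tau> i \<omega> = \<tau> i \<omega> - \<tau> (i - 1) \<omega>"

definition embedded_signal ::
    "(real \<Rightarrow> 'w \<Rightarrow> nat) \<Rightarrow> (nat \<Rightarrow> 'w \<Rightarrow> real) \<Rightarrow> nat \<Rightarrow> 'w \<Rightarrow> nat" where
  "embedded_signal \<sigma> \<tau> j \<omega> = \<sigma> (\<tau> j \<omega>) \<omega>"

(* The sigma-algebra generated by Y 0, ..., Y (j - 1). *)
definition past_algebra :: "'w measure \<Rightarrow> (nat \<Rightarrow> 'w \<Rightarrow> nat) \<Rightarrow> nat \<Rightarrow> 'w measure" where
  "past_algebra M Y j =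
     vimage_algebra (space M) (\<lambda>\<omega>. \<lambda>k\<in>{..<j}. Y k \<omega>) (Pi\<^sub>M {..<j} (\<lambda>_. count_space UNIV))"

definition class_EH ::
    "'w measure \<Rightarrow> nat set \<Rightarrow> (real \<Rightarrow> 'w \<Rightarrow> nat) \<Rightarrow> (nat \<Rightarrow> 'w \<Rightarrow> real) \<Rightarrow> real \<Rightarrow> (nat \<Rightarrow> real) \<Rightarrow> bool" where
  "class_EH M P \<sigma> \<tau> rate q \<longleftrightarrow>
     (let S = holding_time \<tau>; Y = embedded_signal \<sigma> \<tau> in
       rate > 0 \<and> (\<forall>i\<in>P. 0 \<le> q i \<and> q i \<le> 1) \<and>
       prob_space.indep_vars M (\<lambda>_. borel) S {1..} \<and>
       (\<forall>i\<ge>1. distributed M lborel (S i) (exponential_density rate)) \<and>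
       (\<forall>j\<ge>1. \<forall>i\<in>P. AE \<omega> in M.
          real_cond_exp M (past_algebra M Y j) (indicator {\<omega>\<in>space M. Y j \<omega> = i}) \<omega> = q i) \<and>
       prob_space.indep_var M
         (Pi\<^sub>M {1..} (\<lambda>_. borel)) (\<lambda>\<omega>. \<lambda>i\<in>{1..}. S i \<omega>)
         (Pi\<^sub>M UNIV (\<lambda>_. count_space UNIV)) (\<lambda>\<omega> j. Y j \<omega>))"

section \<open>Global asymptotic stability almost surely\<close>

(* Speaking of "the solution x(t), t >= 0" presupposes that a solution exists on all of [0,oo);
   the first conjunct makes this explicit, so that the two others are not vacuous.
   Suprema are taken in the extended reals, since a real-valued Sup of an unbounded set would be
   meaningless. *)
definition globally_asymptotically_stable_as ::
    "'w measure \<Rightarrow> ('i \<Rightarrow> 'a::real_normed_vector \<Rightarrow> 'a) \<Rightarrow> (real \<Rightarrow> 'w \<Rightarrow> 'i) \<Rightarrow> bool" where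
  "globally_asymptotically_stable_as M F \<sigma> \<longleftrightarrow>
     (AE \<omega> in M. \<forall>x0. \<exists>x. caratheodory_solution F (\<lambda>t. \<sigma> t \<omega>) x0 x) \<and>
     (AE \<omega> in M. \<forall>\<epsilon>>0. \<exists>\<delta>>0. \<forall>x0 x.
        caratheodory_solution F (\<lambda>t. \<sigma> t \<omega>) x0 x \<and> norm x0 < \<delta> \<longrightarrow>
        (SUP t\<in>{0..}. ereal (norm (x t))) < ereal \<epsilon>) \<and>
     (AE \<omega> in M. \<forall>r>0. \<forall>\<epsilon>>0. \<exists>T\<ge>0. \<forall>x0 x.
        caratheodory_solution F (\<lambda>t. \<sigma> t \<omega>) x0 x \<and> norm x0 < r \<longrightarrow>
        (SUP t\<in>{T..}. ereal (norm (x t))) < ereal \<epsilon>)"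

end

theory Submission
  imports Defs
begin

text \<open>Between two switching instants \<open>V\<close> grows at most by the exponential factor of the active
  subsystem, and at a switching instant at most by the factor \<open>\<mu>\<close>. Hence along every solution \<open>V\<close> is
  at most its initial value times a product \<open>Z n\<close> that does not depend on the initial state.
  By independence, the expectation of \<open>Z n\<close> decays geometrically, with the ratio that is assumed to
  be less than 1, so the sum of the \<open>Z n\<close> is almost surely finite and \<open>Z n\<close> tends to 0; this gives
  both stability and attractivity. The same computation with the rates 1 shows that
  \<open>exp (- \<tau> n)\<close> tends to 0, so that the switching instants do not accumulate. The a priori bound
  also yields the global existence of solutions.\<close>

text \<open>Some rates \<open>l i\<close> may be negative, so \<open>V\<close> can grow while a
  subsystem is active; only the average over the random holding times contracts. It is computed by
  fixing the word of active indices: then the factors are independent, and each has mean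
  \<open>\<mu>\<close> times the Laplace transform of an exponential law, that is
  \<open>\<mu> / (1 + l i / rate)\<close>, where \<open>l i + rate > 0\<close> ensures finiteness.
  Summation over the words, weighted by products of the \<open>q i\<close>, produces a power of the
  assumed sum. The initial index is not governed by \<open>q\<close>; this costs a constant factor
  but leaves the ratio unchanged.

  Initial states and tolerances are quantified inside the almost sure statements, so the exceptional
  null set has to be fixed before they are chosen. It depends on the signal alone, and everything
  after it is deterministic. There the obstacle is that a Caratheodory solution is differentiable
  only almost everywhere; the integral equation makes it continuously differentiable on each holding
  interval, where the usual differential inequality applies.\<close>

section \<open>Absolutely continuous functions and integral equations\<close>

text \<open>A tagged division is a finite set of pairs, while absolute continuity is formulated for
  intervals numbered by an initial segment of the naturals. A numbering of \<open>I\<close>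
  transports the same \<open>d\<close>.\<close>

lemma absolutely_continuous_on_interval_finite_family:
  fixes x :: "real \<Rightarrow> 'a::real_normed_vector"
  assumes "absolutely_continuous_on_interval a b x" and "e > 0"
  shows "\<exists>d>0. \<forall>(I :: 'i set) u v. finite I \<longrightarrow> (\<forall>i\<in>I. a \<le> u i \<and> u i \<le> v i \<and> v i \<le> b) \<longrightarrow>
       disjoint_family_on (\<lambda>i. {u i<..<v i}) I \<longrightarrow> (\<Sum>i\<in>I. v i - u i) < d \<longrightarrow>
       (\<Sum>i\<in>I. norm (x (v i) - x (u i))) < e"
proof -
  have "\<exists>d>0. \<forall>(n::nat) u v.
        (\<forall>k<n. a \<le> u k \<and> u k \<le> v k \<and> v k \<le> b) \<and>
        disjoint_family_on (\<lambda>k. {u k<..<v k}) {..<n} \<and> (\<Sum>k<n. v k - u k) < d \<longrightarrow>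
        (\<Sum>k<n. norm (x (v k) - x (u k))) < e"
    using assms unfolding absolutely_continuous_on_interval_def by simp
  then obtain d where d: "d > 0" and *: "\<forall>(n::nat) u v.
        (\<forall>k<n. a \<le> u k \<and> u k \<le> v k \<and> v k \<le> b) \<and>
        disjoint_family_on (\<lambda>k. {u k<..<v k}) {..<n} \<and> (\<Sum>k<n. v k - u k) < d \<longrightarrow>
        (\<Sum>k<n. norm (x (v k) - x (u k))) < e"
    by (elim exE conjE)
  show ?thesis
  proof (intro exI[of _ d] conjI allI impI d)
    fix I :: "'i set" and u v
    assume I: "finite I" "\<forall>i\<in>I. a \<le> u i \<and> u i \<le> v i \<and> v i \<le> b"
      "disjoint_family_on (\<lambda>i. {u i<..<v i}) I" "(\<Sum>i\<in>I. v i - u i) < d"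
    obtain h where h: "bij_betw h {..<card I} I"
      using ex_bij_betw_nat_finite[OF I(1)] by (auto simp: atLeast0LessThan)
    have sum_h: "(\<Sum>k<card I. F (h k)) = (\<Sum>i\<in>I. F i)" for F :: "'i \<Rightarrow> real"
      by (rule sum.reindex_bij_betw[OF h])
    have "(\<Sum>k<card I. norm (x (v (h k)) - x (u (h k)))) < e"
    proof (rule *[THEN spec, THEN spec, THEN spec, THEN mp], intro conjI)
      show "\<forall>k<card I. a \<le> u (h k) \<and> u (h k) \<le> v (h k) \<and> v (h k) \<le> b"
        using I(2) bij_betwE[OF h] by auto
      show "disjoint_family_on (\<lambda>k. {u (h k)<..<v (h k)}) {..<card I}"
        unfolding disjoint_family_on_def
      proof (intro ballI impI)
        fix m n assume "m \<in> {..<card I}" "n \<in> {..<card I}" "m \<noteq> n"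
        then have "h m \<in> I" "h n \<in> I" "h m \<noteq> h n"
          using h by (auto simp: bij_betw_def inj_on_def)
        then show "{u (h m)<..<v (h m)} \<inter> {u (h n)<..<v (h n)} = {}"
          using I(3) by (auto simp: disjoint_family_on_def)
      qed
      show "(\<Sum>k<card I. v (h k) - u (h k)) < d"
        using I(4) sum_h[of "\<lambda>i. v i - u i"] by simp
    qed
    then show "(\<Sum>i\<in>I. norm (x (v i) - x (u i))) < e"
      using sum_h[of "\<lambda>i. norm (x (v i) - x (u i))"] by simp
  qed
qed

text \<open>The exceptional points are covered by an open set of small measure, on which absolute
  continuity makes the increments of \<open>x\<close> small; at the remaining points the gauge controls the
  increments as in the proof of the fundamental theorem of calculus.\<close>

lemma absolutely_continuous_has_integral:
  fixes x :: "real \<Rightarrow> 'a::banach"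
  assumes ab: "a \<le> b" and ac: "absolutely_continuous_on_interval a b x" and E: "negligible E"
    and deriv: "\<And>t. t \<in> {a..b} - E \<Longrightarrow> (x has_vector_derivative f t) (at t within {a..b})"
  shows "(f has_integral x b - x a) {a..b}"
proof -
  \<comment> \<open>The value 0 on \<open>E\<close> removes the uncontrolled terms: a piece tagged
    in \<open>E\<close> contributes only an increment of \<open>x\<close>.\<close>
  define g where "g = (\<lambda>t. if t \<in> E then 0 else f t)"
  have "(g has_integral x b - x a) {a..b}"
    unfolding has_integral_real
  proof (intro allI impI)
    fix e :: real assume "e > 0"
    \<comment> \<open>The summand 1 keeps the divisor positive when \<open>a = b\<close>; the factor
      4 in \<open>\<eta>\<close> leaves a strict margin below \<open>e / 2\<close>.\<close>
    define c where "c = b - a + 1"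
    have "c > 0" and "b - a \<le> c" using ab by (auto simp: c_def)
    define \<eta> where "\<eta> = e / (4 * c)"
    have "\<eta> > 0" using \<open>e > 0\<close> \<open>c > 0\<close> by (simp add: \<eta>_def)
    have "\<eta> * (b - a) \<le> \<eta> * c"
      using \<open>\<eta> > 0\<close> \<open>b - a \<le> c\<close> by (intro mult_left_mono) auto
    also have "\<dots> = e / 4"
      using \<open>c > 0\<close> by (simp add: \<eta>_def)
    finally have "\<eta> * (b - a) < e / 2"
      using \<open>e > 0\<close> by simp
    obtain d where "d > 0" and ac': "\<forall>(I :: (real \<times> real set) set) u v. finite I \<longrightarrow>
       (\<forall>i\<in>I. a \<le> u i \<and> u i \<le> v i \<and> v i \<le> b) \<longrightarrow>
       disjoint_family_on (\<lambda>i. {u i<..<v i}) I \<longrightarrow> (\<Sum>i\<in>I. v i - u i) < d \<longrightarrow>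
       (\<Sum>i\<in>I. norm (x (v i) - x (u i))) < e / 2"
      using absolutely_continuous_on_interval_finite_family[OF ac half_gt_zero[OF \<open>e > 0\<close>],
          where 'i = "real \<times> real set"]
      by (elim exE conjE)
    obtain U where U: "open U" "E \<subseteq> U" "emeasure lborel U < ennreal d"
    proof -
      \<comment> \<open>Outer regularity bounds \<open>U - E\<close>; since \<open>E\<close> is
        null, the same bound holds for \<open>U\<close>.\<close>
      obtain U where U: "open U" "E \<subseteq> U" "U - E \<in> lmeasurable" "emeasure lebesgue (U - E) < ennreal d"
        using sets_lebesgue_outer_open[of E d] negligible_imp_sets[OF E] \<open>d > 0\<close> by metis
      have "emeasure lebesgue U = emeasure lebesgue (U - E)"
        using E U(1) by (intro emeasure_Diff_null_set[symmetric])
          (auto simp: negligible_iff_null_sets)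
      moreover have "emeasure lebesgue U = emeasure lborel U"
        using U(1) by simp
      ultimately show thesis using U that by simp
    qed
    have "\<forall>t. \<exists>r>0. t \<in> {a..b} - E \<longrightarrow>
       (\<forall>y\<in>{a..b}. norm (y-t) < r \<longrightarrow> norm (x y - x t - (y-t) *\<^sub>R f t) \<le> \<eta> * norm (y-t))"
    proof
      fix t
      show "\<exists>r>0. t \<in> {a..b} - E \<longrightarrow>
         (\<forall>y\<in>{a..b}. norm (y-t) < r \<longrightarrow> norm (x y - x t - (y-t) *\<^sub>R f t) \<le> \<eta> * norm (y-t))"
      proof (cases "t \<in> {a..b} - E")
        case True
        then show ?thesis
          using deriv[OF True, unfolded has_vector_derivative_def has_derivative_within_alt] \<open>\<eta> > 0\<close>
          by blast
      next
        case False
        then show ?thesis using zero_less_one by blast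
      qed
    qed
    then obtain r where r: "\<And>t. r t > 0" and r_deriv: "\<And>t y. t \<in> {a..b} - E \<Longrightarrow> y \<in> {a..b} \<Longrightarrow>
        norm (y-t) < r t \<Longrightarrow> norm (x y - x t - (y-t) *\<^sub>R f t) \<le> \<eta> * norm (y-t)"
      by metis
    \<comment> \<open>Pieces tagged at exceptional points are forced into \<open>U\<close>; having
      disjoint interiors, they have total length below \<open>d\<close>.\<close>
    define \<gamma> where "\<gamma> = (\<lambda>t. if t \<in> E then U else ball t (r t))"
    have gauge: "gauge \<gamma>"
      using U r by (auto simp: gauge_def \<gamma>_def)
    have approx: "norm ((\<Sum>(t, K)\<in>p. measure lborel K *\<^sub>R g t) - (x b - x a)) < e"
      if p: "p tagged_division_of {a..b}" "\<gamma> fine p" for p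
    proof -
      note pD = tagged_division_ofD[OF p(1)]
      have fin: "finite p" by (rule pD)
      have K: "K = {Inf K..Sup K} \<and> Inf K \<le> t \<and> t \<le> Sup K \<and> a \<le> Inf K \<and> Sup K \<le> b \<and>
          measure lborel K = Sup K - Inf K \<and> K \<subseteq> \<gamma> t" if "(t, K) \<in> p" for t K
      proof -
        obtain u v where uv: "K = {u..v}" using pD(4) \<open>(t, K) \<in> p\<close> by fastforce
        have "t \<in> K" "K \<subseteq> {a..b}" using pD(2,3) \<open>(t, K) \<in> p\<close> by auto
        with uv have "u \<le> t" "t \<le> v" "a \<le> u" "v \<le> b" by auto
        moreover have "K \<subseteq> \<gamma> t" using p(2) that by (auto simp: fine_def)
        ultimately show ?thesis unfolding uv by simp
      qed
      have sum_p: "x b - x a = (\<Sum>(t, K)\<in>p. x (Sup K) - x (Inf K))"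
        "b - a = (\<Sum>(t, K)\<in>p. Sup K - Inf K)"
        using additive_tagged_division_1[OF ab p(1), of x]
          additive_tagged_division_1[OF ab p(1), of "\<lambda>x. x"] by auto
      define p1 where "p1 = {tK \<in> p. fst tK \<in> E}"
      define err where "err = (\<lambda>(t, K). measure lborel K *\<^sub>R g t - (x (Sup K) - x (Inf K)))"
      have p1: "p1 \<subseteq> p" "finite p1" using fin by (auto simp: p1_def)
      have "(\<Sum>tK\<in>p1. norm (err tK)) = (\<Sum>tK\<in>p1. norm (x (Sup (snd tK)) - x (Inf (snd tK))))"
        by (intro sum.cong) (auto simp: p1_def err_def g_def norm_minus_commute)
      also have "\<dots> < e / 2"
      proof (rule ac'[rule_format])
        show "finite p1" by fact
        show "a \<le> Inf (snd i) \<and> Inf (snd i) \<le> Sup (snd i) \<and> Sup (snd i) \<le> b" if "i \<in> p1" for i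
          using K[of "fst i" "snd i"] that p1 by auto
        show disj: "disjoint_family_on (\<lambda>i. {Inf (snd i)<..<Sup (snd i)}) p1"
          unfolding disjoint_family_on_def
        proof (intro ballI impI)
          fix i j assume ij: "i \<in> p1" "j \<in> p1" "i \<noteq> j"
          have "interior (snd i) \<inter> interior (snd j) = {}"
            using pD(5)[of "fst i" "snd i" "fst j" "snd j"] ij p1 by auto
          moreover have "interior (snd i) = {Inf (snd i)<..<Sup (snd i)}" if "i \<in> p1" for i
            using K[of "fst i" "snd i"] that p1 interior_atLeastAtMost_real by (metis prod.collapse subsetD)
          ultimately show "{Inf (snd i)<..<Sup (snd i)} \<inter> {Inf (snd j)<..<Sup (snd j)} = {}"
            using ij by simp
        qed
        have "ennreal (\<Sum>i\<in>p1. Sup (snd i) - Inf (snd i)) = (\<Sum>i\<in>p1. ennreal (Sup (snd i) - Inf (snd i)))"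
          using K p1 by (subst sum_ennreal) force+
        also have "\<dots> = (\<Sum>i\<in>p1. emeasure lborel {Inf (snd i)<..<Sup (snd i)})"
          using K p1 by (intro sum.cong refl) force
        also have "\<dots> = emeasure lborel (\<Union>i\<in>p1. {Inf (snd i)<..<Sup (snd i)})"
          using disj p1 by (intro sum_emeasure) auto
        also have "\<dots> \<le> emeasure lborel U"
        proof (intro emeasure_mono)
          show "(\<Union>i\<in>p1. {Inf (snd i)<..<Sup (snd i)}) \<subseteq> U"
          proof (intro UN_least)
            fix i assume "i \<in> p1"
            then have "snd i \<subseteq> U" "snd i = {Inf (snd i)..Sup (snd i)}"
              using K[of "fst i" "snd i"] p1 by (auto simp: p1_def \<gamma>_def)
            then show "{Inf (snd i)<..<Sup (snd i)} \<subseteq> U"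
              using greaterThanLessThan_subseteq_atLeastAtMost_iff by blast
          qed
        qed (use U in auto)
        finally have "ennreal (\<Sum>i\<in>p1. Sup (snd i) - Inf (snd i)) < ennreal d"
          using U(3) by simp
        then show "(\<Sum>i\<in>p1. Sup (snd i) - Inf (snd i)) < d"
          using ennreal_less_iff \<open>d > 0\<close> by (metis ennreal_leI leD leI)
      qed
      finally have part1: "(\<Sum>tK\<in>p1. norm (err tK)) < e / 2" .
      have "(\<Sum>tK\<in>p - p1. norm (err tK)) \<le> (\<Sum>tK\<in>p - p1. \<eta> * (Sup (snd tK) - Inf (snd tK)))"
      proof (rule sum_mono)
        fix tK assume tK: "tK \<in> p - p1"
        obtain t J where [simp]: "tK = (t, J)" by (cases tK)
        have J: "(t, J) \<in> p" "t \<notin> E" using tK by (auto simp: p1_def)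
        note K' = K[OF J(1)]
        have "t \<in> {a..b} - E" using J K' by auto
        moreover have "J \<subseteq> ball t (r t)" using J K' by (simp add: \<gamma>_def)
        moreover have "Inf J \<in> J" "Sup J \<in> J" using K' by (metis atLeastAtMost_iff order.trans order_refl)+
        ultimately have *: "norm (x (Sup J) - x t - (Sup J - t) *\<^sub>R f t) \<le> \<eta> * norm (Sup J - t)"
          "norm (x (Inf J) - x t - (Inf J - t) *\<^sub>R f t) \<le> \<eta> * norm (Inf J - t)"
          using K' by (intro r_deriv; force simp: dist_norm norm_minus_commute)+
        have len: "measure lborel J = Sup J - Inf J" using K' by blast
        \<comment> \<open>The increment over \<open>J\<close> is split at the tag. As the tag lies
          in \<open>J\<close>, the two distances add up to the length of \<open>J\<close>, which
          makes the errors summable over the division.\<close>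
        have err: "err tK = (x (Inf J) - x t - (Inf J - t) *\<^sub>R f t) - (x (Sup J) - x t - (Sup J - t) *\<^sub>R f t)"
          using J(2) by (simp add: err_def g_def len) (simp add: algebra_simps)
        have "norm (err tK) \<le> \<eta> * norm (Inf J - t) + \<eta> * norm (Sup J - t)"
          unfolding err by (rule order_trans[OF norm_triangle_ineq4 add_mono[OF *(2) *(1)]])
        also have "\<dots> = \<eta> * (Sup J - Inf J)"
          using K' by (simp add: algebra_simps)
        finally show "norm (err tK) \<le> \<eta> * (Sup (snd tK) - Inf (snd tK))" by simp
      qed
      also have "\<dots> \<le> (\<Sum>tK\<in>p. \<eta> * (Sup (snd tK) - Inf (snd tK)))"
        using fin K \<open>\<eta> > 0\<close> by (intro sum_mono2) (auto, force)
      also have "\<dots> = \<eta> * (b - a)"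
        unfolding sum_p(2) by (simp add: sum_distrib_left split_def)
      also have "\<dots> < e / 2" by fact
      finally have part2: "(\<Sum>tK\<in>p - p1. norm (err tK)) < e / 2" .
      have "(\<Sum>(t, K)\<in>p. measure lborel K *\<^sub>R g t) - (x b - x a) = (\<Sum>tK\<in>p. err tK)"
        unfolding sum_p(1) err_def by (simp add: split_def sum_subtractf)
      then have "norm ((\<Sum>(t, K)\<in>p. measure lborel K *\<^sub>R g t) - (x b - x a)) \<le> (\<Sum>tK\<in>p. norm (err tK))"
        by (simp add: norm_sum)
      also have "\<dots> = (\<Sum>tK\<in>p1. norm (err tK)) + (\<Sum>tK\<in>p - p1. norm (err tK))"
        using fin p1 by (metis add.commute sum.subset_diff)
      finally show ?thesis using part1 part2 by simp
    qed
    show "\<exists>\<gamma>. gauge \<gamma> \<and> (\<forall>\<D>. \<D> tagged_division_of {a..b} \<and> \<gamma> fine \<D> \<longrightarrow>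
        norm ((\<Sum>(t, K)\<in>\<D>. measure lborel K *\<^sub>R g t) - (x b - x a)) < e)"
      by (intro exI[of _ \<gamma>] conjI allI impI gauge; elim conjE) (rule approx)
  qed
  then show ?thesis
    by (rule has_integral_spike[OF E, rotated]) (auto simp: g_def)
qed

lemma caratheodory_solution_has_integral:
  fixes F :: "'i \<Rightarrow> 'a::banach \<Rightarrow> 'a"
  assumes sol: "caratheodory_solution F s x0 x" and t: "t \<ge> 0"
  shows "((\<lambda>r. F (s r) (x r)) has_integral x t - x0) {0..t}"
proof -
  have "AE r in lborel. 0 \<le> r \<longrightarrow> (x has_vector_derivative F (s r) (x r)) (at r within {0..})"
    using sol by (simp add: caratheodory_solution_def)
  then obtain E where E: "E \<in> null_sets lborel"
    "\<And>r. r \<notin> E \<Longrightarrow> 0 \<le> r \<Longrightarrow> (x has_vector_derivative F (s r) (x r)) (at r within {0..})"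
    by (auto simp: eventually_ae_filter)
  have "((\<lambda>r. F (s r) (x r)) has_integral x t - x 0) {0..t}"
  proof (rule absolutely_continuous_has_integral[OF t])
    show "absolutely_continuous_on_interval 0 t x"
      using sol t by (simp add: caratheodory_solution_def)
    show "negligible E"
      using E(1) by (simp add: negligible_iff_null_sets null_sets_completionI)
    show "(x has_vector_derivative F (s r) (x r)) (at r within {0..t})" if "r \<in> {0..t} - E" for r
      using E(2)[of r] that by (auto intro: has_vector_derivative_within_subset)
  qed
  then show ?thesis using sol by (simp add: caratheodory_solution_def)
qed

text \<open>The Lyapunov estimates use solutions in this form, which has no exceptional set. The
  horizon \<open>T\<close> is a parameter because the existence proof applies them to a path that is
  known to satisfy the original equation only up to some time.\<close>

definition integral_solution ::
    "('i \<Rightarrow> 'a::real_normed_vector \<Rightarrow> 'a) \<Rightarrow> (real \<Rightarrow> 'i) \<Rightarrow> real \<Rightarrow> 'a \<Rightarrow> (real \<Rightarrow> 'a) \<Rightarrow> bool" where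
  "integral_solution F s T x0 x \<longleftrightarrow>
     (\<forall>t\<in>{0..T}. ((\<lambda>r. F (s r) (x r)) has_integral x t - x0) {0..t})"

lemma integral_solution_0:
  assumes "integral_solution F s T x0 x" "T \<ge> 0"
  shows "x 0 = x0"
proof -
  have "((\<lambda>r. F (s r) (x r)) has_integral x 0 - x0) {0..0}"
    by (rule bspec[OF assms(1)[unfolded integral_solution_def]]) (use assms(2) in simp)
  then have "((\<lambda>r. F (s r) (x r)) has_integral x 0 - x0) {0}"
    by simp
  then have "x 0 - x0 = 0"
    by (rule has_integral_unique[OF _ has_integral_refl(2)])
  then show ?thesis by simp
qed

lemma integral_solution_cong:
  assumes "integral_solution F s T x0 x" "\<And>t. t \<in> {0..T} \<Longrightarrow> F (s t) (x t) = G (s t) (x t)"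
  shows "integral_solution G s T x0 x"
  unfolding integral_solution_def
proof
  fix t assume t: "t \<in> {0..T}"
  have "((\<lambda>r. F (s r) (x r)) has_integral x t - x0) {0..t}"
    using assms(1) t by (simp add: integral_solution_def)
  moreover have "F (s r) (x r) = G (s r) (x r)" if "r \<in> {0..t}" for r
    using assms(2)[of r] t that by simp
  ultimately show "((\<lambda>r. G (s r) (x r)) has_integral x t - x0) {0..t}"
    by (rule has_integral_eq[rotated])
qed

lemma integral_solution_increment:
  fixes F :: "'i \<Rightarrow> 'a::banach \<Rightarrow> 'a"
  assumes sol: "integral_solution F s T x0 x" and ab: "0 \<le> a" "a \<le> b" "b \<le> T"
  shows "((\<lambda>r. F (s r) (x r)) has_integral x b - x a) {a..b}"
proof -
  let ?h = "\<lambda>r. F (s r) (x r)"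
  have b: "(?h has_integral x b - x0) {0..b}" and a: "(?h has_integral x a - x0) {0..a}"
    using sol ab by (auto simp: integral_solution_def)
  have "?h integrable_on {a..b}"
    using ab by (intro integrable_on_subinterval[OF has_integral_integrable[OF b]]) auto
  moreover have "integral {0..a} ?h + integral {a..b} ?h = integral {0..b} ?h"
    by (rule Henstock_Kurzweil_Integration.integral_combine[OF ab(1,2) has_integral_integrable[OF b]])
  ultimately show ?thesis
    using integral_unique[OF a] integral_unique[OF b] by (simp add: has_integral_iff algebra_simps)
qed

lemma integral_solution_continuous_on:
  fixes F :: "'i \<Rightarrow> 'a::banach \<Rightarrow> 'a"
  assumes sol: "integral_solution F s T x0 x"
  shows "continuous_on {0..T} x"
proof (cases "T \<ge> 0")
  case True
  have eq: "x t = x0 + integral {0..t} (\<lambda>r. F (s r) (x r))" if "t \<in> {0..T}" for t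
  proof -
    have "((\<lambda>r. F (s r) (x r)) has_integral x t - x0) {0..t}"
      using sol that by (simp add: integral_solution_def)
    then show ?thesis by (simp add: integral_unique)
  qed
  have "(\<lambda>r. F (s r) (x r)) integrable_on {0..T}"
    using sol True by (auto simp: integral_solution_def)
  then have "continuous_on {0..T} (\<lambda>t. x0 + integral {0..t} (\<lambda>r. F (s r) (x r)))"
    by (intro continuous_on_add continuous_on_const indefinite_integral_continuous_1)
  then show ?thesis
    by (simp only: continuous_on_cong[OF refl eq])
qed auto

section \<open>Switching paths and Lyapunov functions\<close>

text \<open>Multiplying \<open>W\<close> by \<open>exp (c * (t - a))\<close> cancels the expected
  rate and leaves a nonincreasing function. The sign of \<open>c\<close> is arbitrary, so the
  estimate also bounds the growth in unstable subsystems.\<close>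

lemma lyapunov_exp_decay:
  fixes x :: "real \<Rightarrow> 'a::real_normed_vector" and W :: "'a \<Rightarrow> real"
  assumes ab: "a \<le> b"
    and x: "\<And>t. t \<in> {a..b} \<Longrightarrow> (x has_vector_derivative x' t) (at t within {a..b})"
    and W: "\<And>t. t \<in> {a..b} \<Longrightarrow> (W has_derivative W' t) (at (x t))"
    and decr: "\<And>t. t \<in> {a..b} \<Longrightarrow> W' t (x' t) \<le> - c * W (x t)"
  shows "W (x b) \<le> exp (- c * (b - a)) * W (x a)"
proof -
  define \<phi> where "\<phi> = (\<lambda>t. exp (c * (t - a)) * W (x t))"
  have cont_x: "continuous_on {a..b} x"
    using x by (rule continuous_on_vector_derivative)
  have "\<phi> b \<le> \<phi> a"
  proof (rule DERIV_nonpos_imp_decreasing_open[OF ab])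
    fix t assume t: "a < t" "t < b"
    then have t': "t \<in> {a..b}" by simp
    have "(x has_vector_derivative x' t) (at t)"
      using x[OF t'] unfolding at_within_Icc_at[OF t] .
    then have "((\<lambda>t. W (x t)) has_derivative (\<lambda>h. W' t (h *\<^sub>R x' t))) (at t)"
      unfolding has_vector_derivative_def using W[OF t'] by (rule has_derivative_compose)
    moreover have "W' t (h *\<^sub>R x' t) = W' t (x' t) * h" for h
      using linear_simps(5)[OF has_derivative_bounded_linear[OF W[OF t']]] by simp
    ultimately have "((\<lambda>t. W (x t)) has_real_derivative W' t (x' t)) (at t)"
      by (simp add: has_field_derivative_def)
    then have "(\<phi> has_real_derivative exp (c * (t - a)) * (c * W (x t) + W' t (x' t))) (at t)"
      unfolding \<phi>_def by (auto intro!: derivative_eq_intros simp: algebra_simps)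
    moreover have "exp (c * (t - a)) * (c * W (x t) + W' t (x' t)) \<le> 0"
      using decr[OF t'] by (intro mult_nonneg_nonpos) auto
    ultimately show "\<exists>y. DERIV \<phi> t :> y \<and> y \<le> 0" by blast
  next
    have "continuous_on (x ` {a..b}) W"
      using has_derivative_continuous[OF W] by (intro continuous_at_imp_continuous_on) auto
    then have "continuous_on {a..b} (\<lambda>t. W (x t))"
      using cont_x by (rule continuous_on_compose2) auto
    then show "continuous_on {a..b} \<phi>"
      unfolding \<phi>_def by (intro continuous_intros)
  qed
  then have "exp (- c * (b - a)) * (exp (c * (b - a)) * W (x b)) \<le> exp (- c * (b - a)) * W (x a)"
    by (intro mult_left_mono) (auto simp: \<phi>_def)
  moreover have "exp (- c * (b - a)) * (exp (c * (b - a)) * W (x b)) = W (x b)"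
    by (simp add: mult.assoc[symmetric] exp_add[symmetric])
  ultimately show ?thesis by (simp only:)
qed

text \<open>One sample path with the probability removed. \<open>\<tau>_lim\<close> makes the
  holding intervals cover the half-line; \<open>y n\<close> is the index active on the interval that
  starts at \<open>\<tau> n\<close>.\<close>

locale switching_path =
  fixes P :: "'i set" and s :: "real \<Rightarrow> 'i" and \<tau> :: "nat \<Rightarrow> real" and y :: "nat \<Rightarrow> 'i"
  assumes \<tau>_0: "\<tau> 0 = 0" and \<tau>_less: "\<And>n. \<tau> n < \<tau> (Suc n)"
    and \<tau>_lim: "filterlim \<tau> at_top sequentially"
    and s_eq: "\<And>n t. \<tau> n \<le> t \<Longrightarrow> t < \<tau> (Suc n) \<Longrightarrow> s t = y n" and y_in: "\<And>n. y n \<in> P"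
begin

lemma \<tau>_mono: "m \<le> n \<Longrightarrow> \<tau> m \<le> \<tau> n"
  by (rule lift_Suc_mono_le[of \<tau>]) (rule less_imp_le[OF \<tau>_less])

lemma \<tau>_nonneg: "\<tau> n \<ge> 0"
  using \<tau>_mono[of 0 n] by (simp add: \<tau>_0)

lemma \<tau>_exceeds: "\<exists>n. t < \<tau> n"
proof -
  have "eventually (\<lambda>n. t < \<tau> n) sequentially"
    using \<tau>_lim by (simp add: filterlim_at_top_dense)
  then show ?thesis by (auto simp: eventually_sequentially)
qed

lemma interval_cover:
  assumes "t \<ge> 0"
  obtains n where "\<tau> n \<le> t" "t < \<tau> (Suc n)"
proof -
  define m where "m = (LEAST n. t < \<tau> n)"
  have "t < \<tau> m" unfolding m_def using \<tau>_exceeds by (rule LeastI_ex)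
  moreover from this have "m \<noteq> 0" using assms \<tau>_0 by (cases m) auto
  then obtain n where n: "m = Suc n" by (cases m) auto
  moreover have "\<tau> n \<le> t" using not_less_Least[of n "\<lambda>n. t < \<tau> n"] n m_def by simp
  ultimately show thesis using that by blast
qed

text \<open>On a holding interval the active index is constant, so the integrand is continuous and
  the fundamental theorem gives a derivative everywhere, one-sided at the end points.\<close>

lemma integral_solution_deriv:
  fixes F :: "'i \<Rightarrow> 'a::banach \<Rightarrow> 'a"
  assumes sol: "integral_solution F s T x0 x" and cont: "continuous_on UNIV (F (y n))"
    and b: "\<tau> n \<le> b" "b \<le> \<tau> (Suc n)" "b \<le> T" and t: "t \<in> {\<tau> n..b}"
  shows "(x has_vector_derivative F (y n) (x t)) (at t within {\<tau> n..b})"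
proof -
  let ?h = "\<lambda>r. F (y n) (x r)"
  have "continuous_on {\<tau> n..b} x"
    using integral_solution_continuous_on[OF sol] b \<tau>_nonneg[of n] by (rule_tac continuous_on_subset) auto
  then have h: "continuous_on {\<tau> n..b} ?h"
    by (rule continuous_on_compose2[OF cont]) auto
  have eq: "x u = x (\<tau> n) + integral {\<tau> n..u} ?h" if u: "u \<in> {\<tau> n..b}" for u
  proof -
    have "((\<lambda>r. F (s r) (x r)) has_integral x u - x (\<tau> n)) {\<tau> n..u}"
      using u b \<tau>_nonneg[of n] by (intro integral_solution_increment[OF sol]) auto
    \<comment> \<open>At \<open>\<tau> (Suc n)\<close> the signal already has its next value; a
      single point leaves the integral unchanged.\<close>
    moreover have "?h r = F (s r) (x r)" if "r \<in> {\<tau> n..u} - {\<tau> (Suc n)}" for r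
      using that u b s_eq[of n r] by auto
    ultimately have "(?h has_integral x u - x (\<tau> n)) {\<tau> n..u}"
      by (rule_tac has_integral_spike_finite[of "{\<tau> (Suc n)}"]) auto
    then show ?thesis by (simp add: integral_unique)
  qed
  have "((\<lambda>u. x (\<tau> n) + integral {\<tau> n..u} ?h) has_vector_derivative ?h t) (at t within {\<tau> n..b})"
    using integral_has_vector_derivative[OF h t] by (auto intro!: derivative_eq_intros)
  then show ?thesis
    by (rule has_vector_derivative_transform[OF t, rotated]) (rule eq)
qed

end

locale switched_lyapunov = switching_path P s \<tau> y
  for P :: "'i set" and s :: "real \<Rightarrow> 'i" and \<tau> y +
  fixes F :: "'i \<Rightarrow> 'a::euclidean_space \<Rightarrow> 'a" and V :: "'i \<Rightarrow> 'a \<Rightarrow> real"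
    and V' :: "'i \<Rightarrow> 'a \<Rightarrow> 'a \<Rightarrow> real" and \<mu> :: real and l :: "'i \<Rightarrow> real"
  assumes F_cont: "\<And>i. i \<in> P \<Longrightarrow> continuous_on UNIV (F i)"
    and V_deriv: "\<And>i z. i \<in> P \<Longrightarrow> (V i has_derivative V' i z) (at z)"
    and V_decr: "\<And>i z. i \<in> P \<Longrightarrow> V' i z (F i z) \<le> - l i * V i z"
    and V_nonneg: "\<And>i z. i \<in> P \<Longrightarrow> V i z \<ge> 0"
    and V_jump: "\<And>i j z. i \<in> P \<Longrightarrow> j \<in> P \<Longrightarrow> V i z \<le> \<mu> * V j z" and \<mu>: "\<mu> > 1"
begin

text \<open>The \<open>Z n\<close> of the overview along one path. Each factor covers a holding
  interval together with the switch that ends it, so \<open>decay n\<close> accounts for the growth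
  up to just after the switch at \<open>\<tau> n\<close>.\<close>

definition decay :: "nat \<Rightarrow> real" where
  "decay n = (\<Prod>j<n. \<mu> * exp (- l (y j) * (\<tau> (Suc j) - \<tau> j)))"

lemma decay_0: "decay 0 = 1"
  by (simp add: decay_def)

lemma decay_Suc: "decay (Suc n) = decay n * (\<mu> * exp (- l (y n) * (\<tau> (Suc n) - \<tau> n)))"
  by (simp add: decay_def)

lemma decay_pos: "decay n > 0"
  using \<mu> by (auto simp: decay_def intro!: prod_pos)

text \<open>Induction over the switching instants. The state does not jump there, but the Lyapunov
  function in force changes from \<open>V (y n)\<close> to \<open>V (y (Suc n))\<close>, which costs
  the factor \<open>\<mu>\<close>. The estimate for one interval includes its right end, still with
  the old function, so that consecutive pieces meet.\<close>

lemma lyapunov_bound_exp: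
  assumes sol: "integral_solution F s T x0 x"
    and "\<tau> n \<le> t" "t \<le> \<tau> (Suc n)" "t \<le> T"
  shows "V (y n) (x t) \<le> decay n * exp (- l (y n) * (t - \<tau> n)) * V (y 0) x0"
proof -
  have piece: "V (y n) (x t) \<le> exp (- l (y n) * (t - \<tau> n)) * V (y n) (x (\<tau> n))"
    if "\<tau> n \<le> t" "t \<le> \<tau> (Suc n)" "t \<le> T" for n t
    using integral_solution_deriv[OF sol F_cont[OF y_in] that] V_deriv[OF y_in] V_decr[OF y_in] that
    by (intro lyapunov_exp_decay[where x' = "\<lambda>t. F (y n) (x t)" and W' = "\<lambda>t. V' (y n) (x t)"]) auto
  have "V (y n) (x (\<tau> n)) \<le> decay n * V (y 0) x0" if "\<tau> n \<le> T" for n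
    using that
  proof (induct n)
    case 0
    then show ?case
      using integral_solution_0[OF sol] by (simp add: \<tau>_0 decay_0)
  next
    case (Suc n)
    have le: "\<tau> n \<le> \<tau> (Suc n)" using \<tau>_less[of n] by simp
    have "V (y (Suc n)) (x (\<tau> (Suc n))) \<le> \<mu> * V (y n) (x (\<tau> (Suc n)))"
      by (rule V_jump[OF y_in y_in])
    also have "\<dots> \<le> \<mu> * (exp (- l (y n) * (\<tau> (Suc n) - \<tau> n)) * V (y n) (x (\<tau> n)))"
      using \<mu> le Suc(2) by (intro mult_left_mono piece) auto
    also have "\<dots> \<le> \<mu> * (exp (- l (y n) * (\<tau> (Suc n) - \<tau> n)) * (decay n * V (y 0) x0))"
      using \<mu> le Suc by (intro mult_left_mono) auto
    finally show ?case by (simp add: decay_Suc mult_ac)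
  qed
  then have "exp (- l (y n) * (t - \<tau> n)) * V (y n) (x (\<tau> n)) \<le>
      exp (- l (y n) * (t - \<tau> n)) * (decay n * V (y 0) x0)"
    using assms by (intro mult_left_mono) auto
  also have "\<dots> = decay n * exp (- l (y n) * (t - \<tau> n)) * V (y 0) x0"
    by simp
  finally show ?thesis
    using piece[OF assms(2-4)] by (rule order_trans[rotated])
qed

text \<open>An exponential is monotone, so on each interval its maximum is attained at an end point.\<close>

lemma lyapunov_bound:
  assumes sol: "integral_solution F s T x0 x"
    and t: "\<tau> n \<le> t" "t \<le> \<tau> (Suc n)" "t \<le> T"
  shows "V (y n) (x t) \<le> max (decay n) (decay (Suc n)) * V (y 0) x0"
proof -
  have "decay n * exp (- l (y n) * (t - \<tau> n)) \<le> max (decay n) (decay (Suc n))"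
  proof (cases "l (y n) \<ge> 0")
    case True
    then have "exp (- l (y n) * (t - \<tau> n)) \<le> 1"
      using t by (simp add: mult_nonneg_nonneg)
    then have "decay n * exp (- l (y n) * (t - \<tau> n)) \<le> decay n * 1"
      using decay_pos[of n] by (intro mult_left_mono) auto
    then show ?thesis by simp
  next
    case False
    then have "exp (- l (y n) * (t - \<tau> n)) \<le> exp (- l (y n) * (\<tau> (Suc n) - \<tau> n))"
      using t by (simp add: mult_left_mono)
    \<comment> \<open>\<open>decay (Suc n)\<close> already contains the factor of the coming switch;
      as \<open>\<mu> > 1\<close>, including it early only weakens the bound.\<close>
    also have "\<dots> \<le> \<mu> * exp (- l (y n) * (\<tau> (Suc n) - \<tau> n))"
      using \<mu> by simp
    finally have "decay n * exp (- l (y n) * (t - \<tau> n)) \<le> decay (Suc n)"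
      unfolding decay_Suc using decay_pos[of n] by (intro mult_left_mono) auto
    then show ?thesis by simp
  qed
  then have "decay n * exp (- l (y n) * (t - \<tau> n)) * V (y 0) x0 \<le> max (decay n) (decay (Suc n)) * V (y 0) x0"
    by (intro mult_right_mono V_nonneg y_in)
  with lyapunov_bound_exp[OF assms] show ?thesis by simp
qed

end

section \<open>Global existence of solutions\<close>

lemma norm_integral_increment_le:
  fixes h :: "real \<Rightarrow> 'a::euclidean_space"
  assumes int: "h integrable_on {0..b}" and bd: "\<And>r. r \<in> {0..b} \<Longrightarrow> norm (h r) \<le> B"
    and ab: "0 \<le> a" "a \<le> b"
  shows "norm (integral {0..b} h - integral {0..a} h) \<le> B * (b - a)"
proof -
  have "integral {0..a} h + integral {a..b} h = integral {0..b} h"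
    by (rule Henstock_Kurzweil_Integration.integral_combine[OF ab int])
  then have eq: "integral {0..b} h - integral {0..a} h = integral {a..b} h"
    by (simp add: algebra_simps)
  have "h integrable_on {a..b}"
    using ab by (intro integrable_on_subinterval[OF int]) auto
  moreover have "B \<ge> 0"
    by (rule order_trans[OF norm_ge_zero bd[of a]]) (use ab in simp)
  ultimately have "norm (integral {a..b} h) \<le> B * measure lborel {a..b}"
    using bd ab by (intro has_integral_bound_real[OF _ finite.emptyI integrable_integral]) simp_all
  then show ?thesis using eq ab by simp
qed

text \<open>The weight \<open>exp (- 2 * K * t)\<close> makes the Picard operator a contraction on all of
  \<open>{0..}\<close> at once.\<close>

lemma global_picard:
  fixes G :: "real \<Rightarrow> 'a::euclidean_space \<Rightarrow> 'a"
  assumes int: "\<And>z t. continuous_on UNIV z \<Longrightarrow> t \<ge> 0 \<Longrightarrow> (\<lambda>r. G r (z r)) integrable_on {0..t}"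
    and lip: "\<And>r u v. r \<ge> 0 \<Longrightarrow> norm (G r u - G r v) \<le> L * norm (u - v)"
    and bd: "\<And>r u. r \<ge> 0 \<Longrightarrow> norm (G r u) \<le> B"
  shows "\<exists>x. \<forall>t\<ge>0. ((\<lambda>r. G r (x r)) has_integral x t - x0) {0..t}"
proof -
  \<comment> \<open>\<open>K \<ge> 1\<close> makes the weight decay even if
    \<open>L \<le> 0\<close>, and gives \<open>u \<le> exp (2 * K * u)\<close> below.\<close>
  define K where "K = max L 1"
  have K: "K \<ge> 1" "L \<le> K" by (auto simp: K_def)
  have B: "B \<ge> 0" using bd[of 0 0] norm_ge_zero[of "G 0 0"] by linarith
  \<comment> \<open>The unknown is the weighted function \<open>z\<close>; the solution is recovered
    as \<open>exp (2 * K * r) *\<^sub>R z r\<close>. Thus \<open>z\<close> can be sought among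
    bounded functions although the solution may grow.\<close>
  define h where "h = (\<lambda>(z :: real \<Rightarrow>\<^sub>C 'a) r. G r (exp (2 * K * r) *\<^sub>R z r))"
  have h_int: "h z integrable_on {0..t}" if "t \<ge> 0" for z t
    unfolding h_def using that by (intro int continuous_intros) auto
  have h_bd: "norm (h z r) \<le> B" if "r \<ge> 0" for z r
    unfolding h_def using that by (rule bd)
  \<comment> \<open>\<open>max 0 t\<close> extends the operator by a constant to negative times,
    because bounded continuous functions live on the whole line. The result is bounded since the
    integral of a bounded field grows only linearly.\<close>
  define \<Phi> where "\<Phi> = (\<lambda>z t. exp (- 2 * K * max 0 t) *\<^sub>R (x0 + integral {0..max 0 t} (h z)))"
  have bcont: "\<Phi> z \<in> bcontfun" for z
  proof (rule bcontfun_normI)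
    have "B-lipschitz_on {0..} (\<lambda>t. integral {0..t} (h z))"
    proof (rule lipschitz_onI[OF _ B])
      fix a b :: real assume "a \<in> {0..}" "b \<in> {0..}"
      then have ab: "0 \<le> a" "0 \<le> b" by auto
      have incr: "norm (integral {0..v} (h z) - integral {0..u} (h z)) \<le> B * (v - u)"
        if "0 \<le> u" "u \<le> v" for u v
        using that by (intro norm_integral_increment_le h_int h_bd) auto
      show "dist (integral {0..a} (h z)) (integral {0..b} (h z)) \<le> B * dist a b"
      proof (cases "a \<le> b")
        case True
        then have "dist a b = b - a" by (simp add: dist_real_def)
        then show ?thesis
          unfolding dist_norm[of "integral _ _"] using incr[OF ab(1) True] by (simp add: norm_minus_commute)
      next
        case False
        then have "dist a b = a - b" by (simp add: dist_real_def)
        then show ?thesis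
          unfolding dist_norm[of "integral _ _"] using incr[OF ab(2), of a] False by simp
      qed
    qed
    then have "continuous_on {0..} (\<lambda>t. integral {0..t} (h z))"
      by (rule lipschitz_on_continuous_on)
    then have "continuous_on UNIV (\<lambda>t. integral {0..max 0 t} (h z))"
      by (rule continuous_on_compose2) (auto intro!: continuous_intros)
    then show "continuous_on UNIV (\<Phi> z)"
      unfolding \<Phi>_def by (intro continuous_intros)
    show "norm (\<Phi> z t) \<le> norm x0 + B" for t
    proof -
      define u where "u = max 0 t"
      have u: "u \<ge> 0" by (simp add: u_def)
      have "norm (integral {0..u} (h z)) \<le> B * u"
        using norm_integral_increment_le[OF h_int[OF u] h_bd, of 0 z] u by simp
      then have "norm (x0 + integral {0..u} (h z)) \<le> norm x0 + B * u"
        using norm_triangle_ineq[of x0 "integral {0..u} (h z)"] by linarith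
      then have "norm (\<Phi> z t) \<le> exp (- 2 * K * u) * (norm x0 + B * u)"
        unfolding \<Phi>_def u_def[symmetric] norm_scaleR by (simp add: mult_left_mono)
      also have "\<dots> = exp (- 2 * K * u) * norm x0 + B * (exp (- 2 * K * u) * u)"
        by (simp add: algebra_simps)
      also have "\<dots> \<le> 1 * norm x0 + B * 1"
      proof (intro add_mono mult_right_mono mult_left_mono B norm_ge_zero)
        show "exp (- 2 * K * u) \<le> 1" using K u by simp
        have "u \<le> 1 + u" by simp
        also have "\<dots> \<le> exp u" by (rule exp_ge_add_one_self)
        also have "\<dots> \<le> exp (2 * K * u)"
          using mult_right_mono[of 1 "2 * K" u] K u by simp
        finally have "exp (- 2 * K * u) * u \<le> exp (- 2 * K * u) * exp (2 * K * u)"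
          by (intro mult_left_mono) auto
        then show "exp (- 2 * K * u) * u \<le> 1"
          by (simp add: exp_add[symmetric])
      qed
      finally show ?thesis by simp
    qed
  qed
  have appl: "apply_bcontfun (Bcontfun (\<Phi> z)) = \<Phi> z" for z
    using bcont by (rule Bcontfun_inverse)
  have "\<exists>!z. Bcontfun (\<Phi> z) = z"
  proof (rule banach_fix_type[of "1/2"])
    show "\<forall>z w. dist (Bcontfun (\<Phi> z)) (Bcontfun (\<Phi> w)) \<le> 1/2 * dist z w"
    proof (intro allI dist_bound)
      fix z w :: "real \<Rightarrow>\<^sub>C 'a" and t :: real
      define u where "u = max 0 t"
      have u: "u \<ge> 0" by (simp add: u_def)
      define d where "d = dist z w"
      \<comment> \<open>With a weight of rate \<open>2 * K\<close>, this integral is at most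
        \<open>d / 2\<close> times the inverse weight: the origin of the contraction constant
        1/2.\<close>
      have "((\<lambda>r. d * K * exp (2 * K * r)) has_integral d / 2 * exp (2 * K * u) - d / 2 * exp (2 * K * 0)) {0..u}"
        using u K by (intro fundamental_theorem_of_calculus)
          (auto intro!: derivative_eq_intros simp: has_real_derivative_iff_has_vector_derivative[symmetric])
      then have gint: "(\<lambda>r. d * K * exp (2 * K * r)) integrable_on {0..u}"
        and gval: "integral {0..u} (\<lambda>r. d * K * exp (2 * K * r)) =
          d / 2 * exp (2 * K * u) - d / 2 * exp (2 * K * 0)"
        by (rule has_integral_integrable, rule integral_unique)
      have "norm (integral {0..u} (h z) - integral {0..u} (h w)) = norm (integral {0..u} (\<lambda>r. h z r - h w r))"
        by (simp add: integral_diff h_int u)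
      also have "\<dots> \<le> integral {0..u} (\<lambda>r. d * K * exp (2 * K * r))"
      proof (rule integral_norm_bound_integral[OF _ gint])
        show "(\<lambda>r. h z r - h w r) integrable_on {0..u}"
          by (intro integrable_diff h_int u)
        fix r assume "r \<in> {0..u}"
        then have "norm (h z r - h w r) \<le> L * norm (exp (2 * K * r) *\<^sub>R z r - exp (2 * K * r) *\<^sub>R w r)"
          unfolding h_def by (intro lip) auto
        also have "\<dots> = L * (exp (2 * K * r) * dist (z r) (w r))"
          by (simp add: dist_norm scaleR_diff_right[symmetric])
        also have "\<dots> \<le> K * (exp (2 * K * r) * d)"
          unfolding d_def using K dist_bounded[of z r w] by (intro mult_mono) auto
        finally show "norm (h z r - h w r) \<le> d * K * exp (2 * K * r)"
          by (simp add: mult_ac)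
      qed
      also have "\<dots> \<le> d / 2 * exp (2 * K * u)"
        unfolding gval by (simp add: d_def)
      finally have I: "norm (integral {0..u} (h z) - integral {0..u} (h w)) \<le> d / 2 * exp (2 * K * u)" .
      have "\<Phi> z t - \<Phi> w t = exp (- 2 * K * u) *\<^sub>R (integral {0..u} (h z) - integral {0..u} (h w))"
        unfolding \<Phi>_def u_def[symmetric] by (simp add: algebra_simps)
      then have "norm (\<Phi> z t - \<Phi> w t) = exp (- 2 * K * u) * norm (integral {0..u} (h z) - integral {0..u} (h w))"
        by simp
      also have "\<dots> \<le> exp (- 2 * K * u) * (d / 2 * exp (2 * K * u))"
        by (intro mult_left_mono I) auto
      also have "\<dots> = d / 2"
        by (simp add: exp_add[symmetric] mult.left_commute)
      finally show "dist (Bcontfun (\<Phi> z) t) (Bcontfun (\<Phi> w) t) \<le> 1/2 * dist z w"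
        unfolding appl by (simp add: dist_norm d_def)
    qed
  qed auto
  then obtain z where z: "Bcontfun (\<Phi> z) = z" by blast
  have z_eq: "z t = \<Phi> z t" for t
    using appl[of z] unfolding z by simp
  define x where "x = (\<lambda>t. exp (2 * K * t) *\<^sub>R z t)"
  have "((\<lambda>r. G r (x r)) has_integral x t - x0) {0..t}" if t: "t \<ge> 0" for t
  proof -
    have "x t = x0 + integral {0..t} (h z)"
      unfolding x_def z_eq[of t] \<Phi>_def using t by (simp add: exp_add[symmetric])
    moreover have "h z = (\<lambda>r. G r (x r))"
      by (simp add: h_def x_def)
    ultimately show ?thesis
      using h_int[OF t, of z] by (simp add: has_integral_iff)
  qed
  then show ?thesis by blast
qed

section \<open>Lipschitz bounds on compact sets, finite families and comparison functions\<close>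

lemma locally_Lipschitz_continuous_on:
  assumes "locally_Lipschitz h"
  shows "continuous_on S h"
proof -
  have "continuous_on UNIV h"
    by (rule local_lipschitz_continuous_on[OF assms[unfolded locally_Lipschitz_def], of 0]) simp
  then show ?thesis by (rule continuous_on_subset) simp
qed

lemma locally_Lipschitz_lipschitz_on_compact:
  assumes "locally_Lipschitz h" and "compact S"
  obtains L where "L-lipschitz_on S h"
proof -
  have "local_lipschitz {0::real} S (\<lambda>_. h)"
    using assms(1) unfolding locally_Lipschitz_def by (rule local_lipschitz_subset) auto
  then obtain L where "\<And>t. t \<in> {0::real} \<Longrightarrow> L-lipschitz_on S h"
    using assms(2) by (rule local_lipschitz_compact_implies_lipschitz) auto
  then show thesis using that by blast
qed

lemma uniform_bound_finite:
  fixes b :: "'i \<Rightarrow> real"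
  assumes "finite P"
  obtains B where "B \<ge> 0" "\<And>i. i \<in> P \<Longrightarrow> b i \<le> B"
proof
  show "(\<Sum>i\<in>P. \<bar>b i\<bar>) \<ge> 0" by (simp add: sum_nonneg)
  show "b i \<le> (\<Sum>i\<in>P. \<bar>b i\<bar>)" if "i \<in> P" for i
    using member_le_sum[of i P "\<lambda>i. \<bar>b i\<bar>"] that assms by simp
qed

lemma class_K_infinity_unbounded:
  assumes "class_K_infinity \<alpha>"
  obtains R where "R > 0" "\<alpha> R > c"
proof -
  have K: "\<alpha> ` {0..} \<subseteq> {0..}" and \<alpha>0: "\<alpha> 0 = 0" and unb: "\<not> bounded (\<alpha> ` {0..})"
    using assms by (auto simp: class_K_infinity_def class_K_def)
  obtain R where R: "R \<ge> 0" "norm (\<alpha> R) > \<bar>c\<bar>"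
    using unb unfolding bounded_iff by (auto simp: not_le)
  moreover have "\<alpha> R \<ge> 0" using K R(1) by auto
  moreover have "R \<noteq> 0" using R(2) \<alpha>0 by auto
  ultimately show thesis using that[of R] by auto
qed

text \<open>Takes the place of an inverse of \<open>\<alpha>\<close>: estimates of
  \<open>\<alpha> (norm x)\<close> become estimates of \<open>norm x\<close>.\<close>

lemma class_K_infinity_less_imp:
  assumes "class_K_infinity \<alpha>" "0 \<le> a" "0 \<le> b" "\<alpha> a < \<alpha> b"
  shows "a < b"
proof (rule ccontr)
  assume "\<not> a < b"
  moreover have "strict_mono_on {0..} \<alpha>"
    using assms by (auto simp: class_K_infinity_def class_K_def)
  ultimately have "\<alpha> b \<le> \<alpha> a"
    using assms(2,3) by (auto simp: strict_mono_on_def le_less not_less)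
  then show False using assms(4) by simp
qed

text \<open>A bounded field makes \<open>x\<close> Lipschitz with constant \<open>B'\<close>; as
  \<open>B'\<close> is positive, \<open>e / B'\<close> can serve as the threshold.\<close>

lemma integral_solution_absolutely_continuous:
  fixes F :: "'i \<Rightarrow> 'a::euclidean_space \<Rightarrow> 'a"
  assumes sol: "integral_solution F s T x0 x"
    and bd: "\<And>r. r \<in> {0..T} \<Longrightarrow> norm (F (s r) (x r)) \<le> B"
  shows "absolutely_continuous_on_interval 0 T x"
  unfolding absolutely_continuous_on_interval_def
proof (intro allI impI)
  fix e :: real assume e: "e > 0"
  define B' where "B' = max B 1"
  have B': "B' > 0" "B \<le> B'" by (auto simp: B'_def)
  have incr: "norm (x v - x u) \<le> B' * (v - u)" if "0 \<le> u" "u \<le> v" "v \<le> T" for u v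
  proof -
    have "norm (x v - x u) \<le> B' * measure lborel {u..v}"
    proof (rule has_integral_bound_real[where S = "{}"])
      show "((\<lambda>r. F (s r) (x r)) has_integral x v - x u) {u..v}"
        using integral_solution_increment[OF sol that] .
      show "norm (F (s r) (x r)) \<le> B'" if "r \<in> {u..v} - {}" for r
        using bd[of r] that \<open>0 \<le> u\<close> \<open>v \<le> T\<close> B' by auto
    qed (use B' in auto)
    then show ?thesis using that by simp
  qed
  show "\<exists>d>0. \<forall>(n::nat) u v. (\<forall>k<n. 0 \<le> u k \<and> u k \<le> v k \<and> v k \<le> T) \<and>
      disjoint_family_on (\<lambda>k. {u k<..<v k}) {..<n} \<and> (\<Sum>k<n. v k - u k) < d \<longrightarrow>
      (\<Sum>k<n. norm (x (v k) - x (u k))) < e"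
  proof (intro exI[of _ "e / B'"] conjI allI impI; (elim conjE)?)
    show "e / B' > 0" using e B' by simp
    fix n :: nat and u v
    assume uv: "\<forall>k<n. 0 \<le> u k \<and> u k \<le> v k \<and> v k \<le> T" "(\<Sum>k<n. v k - u k) < e / B'"
    have "(\<Sum>k<n. norm (x (v k) - x (u k))) \<le> (\<Sum>k<n. B' * (v k - u k))"
      using uv by (intro sum_mono incr) auto
    also have "\<dots> = B' * (\<Sum>k<n. v k - u k)"
      by (simp add: sum_distrib_left)
    also have "\<dots> < e"
      using uv(2) B' by (simp add: field_simps)
    finally show "(\<Sum>k<n. norm (x (v k) - x (u k))) < e" .
  qed
qed

context switching_path
begin

text \<open>Integrability over \<open>{0..\<tau> n}\<close> is assembled interval by interval; on
  each, the integrand differs from a continuous function at most at the right end. As the instants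
  are unbounded, every \<open>t\<close> is reached.\<close>

lemma path_integrable:
  fixes F :: "'i \<Rightarrow> 'a::euclidean_space \<Rightarrow> 'b::euclidean_space"
  assumes F: "\<And>i. i \<in> P \<Longrightarrow> continuous_on UNIV (F i)" and z: "continuous_on UNIV z"
  shows "(\<lambda>r. F (s r) (z r)) integrable_on {0..t}"
proof -
  have "(\<lambda>r. F (s r) (z r)) integrable_on {0..\<tau> n}" for n
  proof (induction n)
    case 0
    then show ?case using integrable_on_refl[of _ "0::real"] by (simp add: \<tau>_0)
  next
    case (Suc n)
    have "continuous_on {\<tau> n..\<tau> (Suc n)} (\<lambda>r. F (y n) (z r))"
      by (rule continuous_on_compose2[OF F[OF y_in] continuous_on_subset[OF z]]) auto
    then have "(\<lambda>r. F (y n) (z r)) integrable_on {\<tau> n..\<tau> (Suc n)}"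
      by (rule integrable_continuous_real)
    moreover have "F (s r) (z r) = F (y n) (z r)" if "r \<in> {\<tau> n..\<tau> (Suc n)} - {\<tau> (Suc n)}" for r
      using s_eq[of n r] that by simp
    ultimately have "(\<lambda>r. F (s r) (z r)) integrable_on {\<tau> n..\<tau> (Suc n)}"
      by (rule integrable_spike_finite[of "{\<tau> (Suc n)}", OF finite.insertI[OF finite.emptyI], rotated])
    then show ?case
      by (rule Henstock_Kurzweil_Integration.integrable_combine[OF \<tau>_nonneg less_imp_le[OF \<tau>_less] Suc.IH])
  qed
  moreover obtain n where "t < \<tau> n" using \<tau>_exceeds by blast
  ultimately show ?thesis
    by (rule_tac integrable_on_subinterval[of _ "{0..\<tau> n}"]) auto
qed

text \<open>The switching instants form a countable, hence null, set. Every other nonnegative time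
  is interior to a holding interval, where the derivative within the closed interval is a full
  derivative.\<close>

lemma integral_solution_imp_caratheodory:
  fixes F :: "'i \<Rightarrow> 'a::euclidean_space \<Rightarrow> 'a"
  assumes F: "\<And>i. i \<in> P \<Longrightarrow> continuous_on UNIV (F i)"
    and sol: "\<And>T. integral_solution F s T x0 x"
    and bd: "\<And>r. r \<ge> 0 \<Longrightarrow> norm (F (s r) (x r)) \<le> B"
  shows "caratheodory_solution F s x0 x"
  unfolding caratheodory_solution_def
proof (intro conjI allI impI)
  show "x 0 = x0" by (rule integral_solution_0[OF sol[of 0]]) simp
  show "absolutely_continuous_on_interval 0 T x" for T
    by (rule integral_solution_absolutely_continuous[OF sol]) (rule bd, simp)
  have "AE t in lborel. t \<notin> range \<tau>"
    by (intro AE_not_in countable_imp_null_set_lborel) auto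
  then show "AE t in lborel. 0 \<le> t \<longrightarrow> (x has_vector_derivative F (s t) (x t)) (at t within {0..})"
  proof (rule eventually_mono, intro impI)
    fix t :: real assume t: "t \<notin> range \<tau>" "0 \<le> t"
    obtain n where n: "\<tau> n \<le> t" "t < \<tau> (Suc n)" using interval_cover[OF t(2)] .
    then have n': "\<tau> n < t" using t(1) by (metis le_less rangeI)
    have "(x has_vector_derivative F (y n) (x t)) (at t within {\<tau> n..\<tau> (Suc n)})"
      using n \<tau>_less[of n] by (intro integral_solution_deriv[OF sol F[OF y_in]]) auto
    then have "(x has_vector_derivative F (y n) (x t)) (at t)"
      unfolding at_within_Icc_at[OF n' n(2)] .
    then show "(x has_vector_derivative F (s t) (x t)) (at t within {0..})"
      unfolding s_eq[OF n] by (rule has_vector_derivative_at_within)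
  qed
qed

end

lemma class_K_infinity_nonneg:
  assumes "class_K_infinity \<alpha>" "r \<ge> 0"
  shows "\<alpha> r \<ge> 0"
proof -
  have "\<alpha> ` {0..} \<subseteq> {0..}" using assms(1) by (simp add: class_K_infinity_def class_K_def)
  then show ?thesis using assms(2) by auto
qed

lemma class_K_infinity_pos:
  assumes "class_K_infinity \<alpha>" "r > 0"
  shows "\<alpha> r > 0"
proof -
  have "strict_mono_on {0..} \<alpha>" "\<alpha> 0 = 0"
    using assms(1) by (simp_all add: class_K_infinity_def class_K_def)
  then show ?thesis using assms(2) strict_mono_onD[of "{0..}" \<alpha> 0 r] by simp
qed

lemma class_K_infinity_mono:
  assumes "class_K_infinity \<alpha>" "0 \<le> a" "a \<le> b"
  shows "\<alpha> a \<le> \<alpha> b"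
  using class_K_infinity_less_imp[OF assms(1), of b a] assms(2,3) by linarith

lemma class_K_infinity_small:
  assumes "class_K_infinity \<alpha>" "c > 0"
  obtains d where "d > 0" "\<And>r. 0 \<le> r \<Longrightarrow> r < d \<Longrightarrow> \<alpha> r < c"
proof -
  have cont: "continuous_on {0..} \<alpha>" and 0: "\<alpha> 0 = 0"
    using assms(1) by (simp_all add: class_K_infinity_def class_K_def)
  from cont obtain d where "d > 0" "\<And>r. r \<in> {0..} \<Longrightarrow> dist r 0 < d \<Longrightarrow> dist (\<alpha> r) (\<alpha> 0) < c"
    unfolding continuous_on_iff using assms(2) by force
  then show thesis using that[of d] 0 by (force simp: dist_real_def)
qed

context switched_lyapunov
begin

lemma decay_bound_interval:
  assumes sol: "integral_solution F s T x0 x" and D: "\<And>n. decay n \<le> D" and t: "t \<in> {0..T}"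
    and \<alpha>: "\<And>i z. i \<in> P \<Longrightarrow> \<alpha> (norm z) \<le> V i z"
  shows "\<alpha> (norm (x t)) \<le> D * V (y 0) x0"
proof -
  obtain n where n: "\<tau> n \<le> t" "t < \<tau> (Suc n)" using interval_cover[of t] t by auto
  have "\<alpha> (norm (x t)) \<le> V (y n) (x t)" by (rule \<alpha>[OF y_in])
  also have "\<dots> \<le> max (decay n) (decay (Suc n)) * V (y 0) x0"
    using n t by (intro lyapunov_bound[OF sol]) auto
  also have "\<dots> \<le> D * V (y 0) x0"
    using D by (intro mult_right_mono V_nonneg y_in) auto
  finally show ?thesis .
qed

text \<open>The fields are composed with the projection onto a ball whose radius exceeds the a priori
  bound of the Lyapunov functions, which makes them globally Lipschitz. By continuity, the solution
  of the modified equation cannot reach the boundary of that ball.\<close>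

lemma exists_caratheodory_solution:
  assumes fin: "finite P" and lip: "\<And>i. i \<in> P \<Longrightarrow> locally_Lipschitz (F i)"
    and K: "class_K_infinity \<alpha>" and \<alpha>: "\<And>i z. i \<in> P \<Longrightarrow> \<alpha> (norm z) \<le> V i z"
    and D: "\<And>n. decay n \<le> D"
  shows "\<exists>x. caratheodory_solution F s x0 x"
proof -
  obtain R where R: "R > 0" "\<alpha> R > D * V (y 0) x0"
    by (rule class_K_infinity_unbounded[OF K])
  define B where "B = cball (0::'a) R"
  have B: "convex B" "closed B" "B \<noteq> {}" "compact B" "0 \<in> B" using R(1) by (auto simp: B_def)
  \<comment> \<open>Projection onto a closed convex set is nonexpansive, so on the whole space
    \<open>G\<close> inherits the Lipschitz constant and the bound that \<open>F\<close> has on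
    \<open>B\<close>.\<close>
  define G where "G = (\<lambda>i z. F i (closest_point B z))"
  have G_eq: "G i z = F i z" if "z \<in> B" for i z
    unfolding G_def by (simp add: closest_point_self[OF that])
  have in_B: "closest_point B z \<in> B" for z by (rule closest_point_in_set[OF B(2,3)])
  have "\<forall>i\<in>P. \<exists>L. L-lipschitz_on B (F i)"
    using locally_Lipschitz_lipschitz_on_compact[OF lip B(4)] by blast
  then obtain Li where Li: "\<And>i. i \<in> P \<Longrightarrow> (Li i)-lipschitz_on B (F i)" by metis
  obtain L where L: "\<And>i. i \<in> P \<Longrightarrow> Li i \<le> L" using uniform_bound_finite[OF fin] by metis
  have G_lip: "norm (G i u - G i v) \<le> L * norm (u - v)" if i: "i \<in> P" for i u v
  proof -
    have "norm (G i u - G i v) \<le> Li i * dist (closest_point B u) (closest_point B v)"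
      unfolding G_def dist_norm[symmetric] by (rule lipschitz_onD[OF Li[OF i] in_B in_B])
    also have "\<dots> \<le> L * dist u v"
      using lipschitz_on_nonneg[OF Li[OF i]] L[OF i] closest_point_lipschitz[OF B(1-3)]
      by (intro mult_mono) auto
    finally show ?thesis by (simp add: dist_norm)
  qed
  have "\<exists>b. \<forall>z\<in>B. norm (F i z) \<le> b" if "i \<in> P" for i
    using compact_imp_bounded[OF compact_continuous_image[OF
        continuous_on_subset[OF F_cont[OF that] subset_UNIV] B(4)]]
    by (auto simp: bounded_iff)
  then obtain bi where bi: "\<And>i z. i \<in> P \<Longrightarrow> z \<in> B \<Longrightarrow> norm (F i z) \<le> bi i" by metis
  obtain b where "\<And>i. i \<in> P \<Longrightarrow> bi i \<le> b" using uniform_bound_finite[OF fin] by metis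
  with bi have b: "norm (F i z) \<le> b" if "i \<in> P" "z \<in> B" for i z
    using that by (meson order_trans)
  have s_in: "s r \<in> P" if "r \<ge> 0" for r
    using interval_cover[OF that] s_eq y_in by metis
  have G_cont: "continuous_on UNIV (G i)" if "i \<in> P" for i
    unfolding G_def using continuous_on_closest_point[OF B(1-3)]
    by (rule continuous_on_compose2[OF F_cont[OF that]]) auto
  have "\<exists>x. \<forall>t\<ge>0. ((\<lambda>r. G (s r) (x r)) has_integral x t - x0) {0..t}"
  proof (rule global_picard)
    show "(\<lambda>r. G (s r) (z r)) integrable_on {0..t}" if "continuous_on UNIV z" for z t
      using G_cont that by (rule path_integrable)
    show "norm (G (s r) u - G (s r) v) \<le> L * norm (u - v)" if "r \<ge> 0" for r u v
      by (rule G_lip[OF s_in[OF that]])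
    show "norm (G (s r) u) \<le> b" if "r \<ge> 0" for r u
      unfolding G_def by (rule b[OF s_in[OF that] in_B])
  qed
  then obtain x where "\<forall>t\<ge>0. ((\<lambda>r. G (s r) (x r)) has_integral x t - x0) {0..t}"
    by blast
  then have x: "integral_solution G s T x0 x" for T
    unfolding integral_solution_def by simp
  have x_cont: "continuous_on {0..T} x" for T
    by (rule integral_solution_continuous_on[OF x])
  \<comment> \<open>While the path stays in the closed ball it solves the original equation, so the
    Lyapunov bound applies and improves \<open>\<le> R\<close> to \<open>< R\<close>.\<close>
  have apriori: "norm (x T) < R" if T: "T \<ge> 0" and le: "\<And>t. t \<in> {0..T} \<Longrightarrow> norm (x t) \<le> R" for T
  proof -
    have "integral_solution F s T x0 x"
      by (rule integral_solution_cong[OF x]) (use le in \<open>simp add: G_eq B_def\<close>)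
    then have "\<alpha> (norm (x T)) \<le> D * V (y 0) x0"
      by (rule decay_bound_interval[OF _ D _ \<alpha>]) (use T in auto)
    then have "\<alpha> (norm (x T)) < \<alpha> R" using R(2) by simp
    then show ?thesis
      by (rule class_K_infinity_less_imp[OF K norm_ge_zero less_imp_le[OF R(1)]])
  qed
  have bounded: "norm (x t) \<le> R" if t: "t \<ge> 0" for t
  proof (rule ccontr)
    assume "\<not> norm (x t) \<le> R"
    \<comment> \<open>The times on the sphere: \<open>C\<close> is compact and, by the intermediate
      value theorem, nonempty, so it has a least element \<open>t1\<close>. Before \<open>t1\<close>
      the path cannot exceed \<open>R\<close> without an earlier crossing, and then
      \<open>apriori\<close> at \<open>t1\<close> gives the contradiction.\<close>
    define C where "C = {r \<in> {0..t}. norm (x r) = R}"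
    have "x 0 = x0" using integral_solution_0[OF x[of 0]] by simp
    \<comment> \<open>\<open>decay 0 = 1\<close> forces \<open>D \<ge> 1\<close>, so the initial
      state lies strictly inside the ball.\<close>
    moreover have "D \<ge> 1" using D[of 0] by (simp add: decay_0)
    then have "1 * V (y 0) x0 \<le> D * V (y 0) x0"
      by (intro mult_right_mono V_nonneg y_in)
    then have "\<alpha> (norm x0) < \<alpha> R"
      using \<alpha>[OF y_in, of x0 0] R(2) by linarith
    then have "norm x0 < R"
      by (rule class_K_infinity_less_imp[OF K norm_ge_zero less_imp_le[OF R(1)]])
    ultimately have x0: "norm (x 0) < R" by simp
    have ivt: "\<exists>r\<ge>0. r \<le> u \<and> norm (x r) = R" if "u \<ge> 0" "norm (x u) \<ge> R" for u
      using that x0 by (intro IVT' continuous_intros x_cont) auto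
    have C_compact: "compact C"
    proof -
      have "continuous_on {0..t} (\<lambda>r. norm (x r))" by (intro continuous_intros x_cont)
      then have "closed ({0..t} \<inter> (\<lambda>r. norm (x r)) -` {R})"
        by (rule continuous_closed_preimage) auto
      moreover have "C = {0..t} \<inter> ({0..t} \<inter> (\<lambda>r. norm (x r)) -` {R})"
        by (auto simp: C_def)
      ultimately show ?thesis using compact_Int_closed[OF compact_Icc] by metis
    qed
    have C_ne: "C \<noteq> {}"
      using ivt[OF t] \<open>\<not> norm (x t) \<le> R\<close> by (force simp: C_def)
    obtain t1 where t1: "t1 \<in> C" "\<And>r. r \<in> C \<Longrightarrow> t1 \<le> r"
      using compact_attains_inf[OF C_compact C_ne] by blast
    have "norm (x t1) < R"
    proof (rule apriori)
      show "t1 \<ge> 0" using t1(1) by (simp add: C_def)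
      fix u assume u: "u \<in> {0..t1}"
      show "norm (x u) \<le> R"
      proof (rule ccontr)
        assume gt: "\<not> norm (x u) \<le> R"
        then obtain r where r: "r \<ge> 0" "r \<le> u" "norm (x r) = R"
          using ivt[of u] u by auto
        then have "r \<in> C" using u t1(1) by (auto simp: C_def)
        then have "r = u" using t1(2) r u by force
        then show False using gt r by simp
      qed
    qed
    then show False using t1(1) by (simp add: C_def)
  qed
  have "caratheodory_solution F s x0 x"
  proof (rule integral_solution_imp_caratheodory[OF F_cont])
    show "integral_solution F s T x0 x" for T
      by (rule integral_solution_cong[OF x]) (use bounded in \<open>simp add: G_eq B_def\<close>)
    show "norm (F (s r) (x r)) \<le> b" if "r \<ge> 0" for r
      using bounded[OF that] s_in[OF that] by (intro b) (auto simp: B_def)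
  qed
  then show ?thesis by blast
qed

lemma caratheodory_lyapunov_bound:
  assumes sol: "caratheodory_solution F s x0 x" and n: "\<tau> n \<le> t" "t \<le> \<tau> (Suc n)"
    and V1: "\<And>i z. i \<in> P \<Longrightarrow> \<alpha>\<^sub>1 (norm z) \<le> V i z"
    and V2: "\<And>i z. i \<in> P \<Longrightarrow> V i z \<le> \<alpha>\<^sub>2 (norm z)"
  shows "\<alpha>\<^sub>1 (norm (x t)) \<le> max (decay n) (decay (Suc n)) * \<alpha>\<^sub>2 (norm x0)"
proof -
  have int: "integral_solution F s t x0 x"
    unfolding integral_solution_def using caratheodory_solution_has_integral[OF sol] by simp
  have "\<alpha>\<^sub>1 (norm (x t)) \<le> V (y n) (x t)" by (rule V1[OF y_in])
  also have "\<dots> \<le> max (decay n) (decay (Suc n)) * V (y 0) x0"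
    by (rule lyapunov_bound[OF int n]) simp
  also have "\<dots> \<le> max (decay n) (decay (Suc n)) * \<alpha>\<^sub>2 (norm x0)"
    using decay_pos[of n] by (intro mult_left_mono V2 y_in) auto
  finally show ?thesis .
qed

section \<open>Stability and attractivity along one path\<close>

lemma stable_path:
  assumes K1: "class_K_infinity \<alpha>\<^sub>1" and K2: "class_K_infinity \<alpha>\<^sub>2"
    and V1: "\<And>i z. i \<in> P \<Longrightarrow> \<alpha>\<^sub>1 (norm z) \<le> V i z"
    and V2: "\<And>i z. i \<in> P \<Longrightarrow> V i z \<le> \<alpha>\<^sub>2 (norm z)"
    and D: "\<And>n. decay n \<le> D" and e: "e > 0"
  shows "\<exists>d>0. \<forall>x0 x. caratheodory_solution F s x0 x \<and> norm x0 < d \<longrightarrow>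
    (\<forall>t\<ge>0. norm (x t) < e)"
proof -
  have D0: "D > 0" using D[of 0] by (simp add: decay_0)
  \<comment> \<open>The threshold comes from solving
    \<open>D * \<alpha>\<^sub>2 (norm x0) < \<alpha>\<^sub>1 e\<close>; it depends on the signal
    only through \<open>D\<close>.\<close>
  obtain d where d: "d > 0" "\<And>r. 0 \<le> r \<Longrightarrow> r < d \<Longrightarrow> \<alpha>\<^sub>2 r < \<alpha>\<^sub>1 e / D"
    using class_K_infinity_small[OF K2, of "\<alpha>\<^sub>1 e / D"] class_K_infinity_pos[OF K1 e] D0
    by (metis divide_pos_pos)
  show ?thesis
  proof (intro exI[of _ d] conjI d(1) allI impI, elim conjE)
    fix x0 x and t :: real
    assume x: "caratheodory_solution F s x0 x" "norm x0 < d" and t: "0 \<le> t"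
    obtain n where n: "\<tau> n \<le> t" "t < \<tau> (Suc n)" using interval_cover[OF t] .
    have "\<alpha>\<^sub>1 (norm (x t)) \<le> max (decay n) (decay (Suc n)) * \<alpha>\<^sub>2 (norm x0)"
      using n by (intro caratheodory_lyapunov_bound[OF x(1) _ _ V1 V2]) auto
    also have "\<dots> \<le> D * \<alpha>\<^sub>2 (norm x0)"
      using D by (intro mult_right_mono class_K_infinity_nonneg[OF K2]) auto
    also have "\<dots> < \<alpha>\<^sub>1 e"
      using d(2)[of "norm x0"] x(2) D0 by (simp add: field_simps)
    finally show "norm (x t) < e"
      by (rule class_K_infinity_less_imp[OF K1 norm_ge_zero less_imp_le[OF e]])
  qed
qed

text \<open>\<open>T\<close> can be taken as a switching instant \<open>\<tau> m\<close>: any later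
  time lies in a holding interval of index at least \<open>m\<close>, and both decay products that
  bound \<open>V\<close> there are below the threshold. Neither \<open>m\<close> nor
  \<open>T\<close> depends on the initial state.\<close>

lemma attractive_path:
  assumes K1: "class_K_infinity \<alpha>\<^sub>1" and K2: "class_K_infinity \<alpha>\<^sub>2"
    and V1: "\<And>i z. i \<in> P \<Longrightarrow> \<alpha>\<^sub>1 (norm z) \<le> V i z"
    and V2: "\<And>i z. i \<in> P \<Longrightarrow> V i z \<le> \<alpha>\<^sub>2 (norm z)"
    and lim: "decay \<longlonglongrightarrow> 0" and e: "e > 0"
  shows "\<exists>T\<ge>0. \<forall>x0 x. caratheodory_solution F s x0 x \<and> norm x0 < r \<longrightarrow>
    (\<forall>t\<ge>T. norm (x t) < e)"
proof -
  \<comment> \<open>The absolute value keeps the argument in the domain of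
    \<open>\<alpha>\<^sub>2\<close>, and adding 1 makes \<open>c\<close> a positive divisor.\<close>
  define c where "c = \<alpha>\<^sub>2 \<bar>r\<bar> + 1"
  have c: "c > 0" using class_K_infinity_nonneg[OF K2, of "\<bar>r\<bar>"] by (simp add: c_def)
  have "eventually (\<lambda>n. decay n < \<alpha>\<^sub>1 e / c) sequentially"
    using lim class_K_infinity_pos[OF K1 e] c by (intro order_tendstoD(2)[OF lim]) auto
  then obtain m where m: "\<And>n. n \<ge> m \<Longrightarrow> decay n < \<alpha>\<^sub>1 e / c"
    by (auto simp: eventually_sequentially)
  show ?thesis
  proof (intro exI[of _ "\<tau> m"] conjI \<tau>_nonneg allI impI, elim conjE)
    fix x0 x and t :: real
    assume x: "caratheodory_solution F s x0 x" "norm x0 < r" and t: "\<tau> m \<le> t"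
    obtain n where n: "\<tau> n \<le> t" "t < \<tau> (Suc n)"
      using interval_cover[of t] t \<tau>_nonneg[of m] by auto
    have "m \<le> n"
    proof (rule ccontr)
      assume "\<not> m \<le> n"
      then have "\<tau> (Suc n) \<le> \<tau> m" by (intro \<tau>_mono) simp
      then show False using n t by simp
    qed
    then have dn: "max (decay n) (decay (Suc n)) < \<alpha>\<^sub>1 e / c" using m by simp
    have "\<alpha>\<^sub>2 (norm x0) \<le> \<alpha>\<^sub>2 \<bar>r\<bar>"
      using x(2) by (intro class_K_infinity_mono[OF K2]) auto
    then have c': "\<alpha>\<^sub>2 (norm x0) \<le> c" by (simp add: c_def)
    have "\<alpha>\<^sub>1 (norm (x t)) \<le> max (decay n) (decay (Suc n)) * \<alpha>\<^sub>2 (norm x0)"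
      using n by (intro caratheodory_lyapunov_bound[OF x(1) _ _ V1 V2]) auto
    also have "\<dots> \<le> max (decay n) (decay (Suc n)) * c"
      using decay_pos[of n] by (intro mult_left_mono c') auto
    also have "\<dots> < \<alpha>\<^sub>1 e"
      using mult_strict_right_mono[OF dn c] c by simp
    finally show "norm (x t) < e"
      by (rule class_K_infinity_less_imp[OF K1 norm_ge_zero less_imp_le[OF e]])
  qed
qed

end

section \<open>Expected decay along the random signal\<close>

context prob_space
begin

section \<open>Law of the next active index given the past\<close>

lemma
  assumes Y: "\<And>k. Y k \<in> measurable M (count_space UNIV)"
  shows subalgebra_past_algebra: "subalgebra M (past_algebra M Y j)"
    and prefix_in_past_algebra: "{\<omega> \<in> space M. \<forall>k<j. Y k \<omega> = w k} \<in> sets (past_algebra M Y j)"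
proof -
  let ?f = "\<lambda>\<omega>. \<lambda>k\<in>{..<j}. Y k \<omega>" and ?N = "Pi\<^sub>M {..<j} (\<lambda>_. count_space UNIV) :: (nat \<Rightarrow> nat) measure"
  have f: "?f \<in> measurable M ?N"
    using Y by (intro measurable_restrict) auto
  have sets_eq: "sets (past_algebra M Y j) = {?f -` A \<inter> space M | A. A \<in> sets ?N}"
    unfolding past_algebra_def using measurable_space[OF f] by (intro sets_vimage_algebra2) auto
  show "subalgebra M (past_algebra M Y j)"
    unfolding subalgebra_def sets_eq
    using measurable_sets[OF f] by (auto simp: past_algebra_def)
  define A where "A = PiE {..<j} (\<lambda>k. {w k})"
  have "A \<in> sets ?N"
    unfolding A_def by (intro sets_PiM_I_finite) auto
  moreover have "?f \<omega> \<in> A \<longleftrightarrow> (\<forall>k<j. Y k \<omega> = w k)" for \<omega>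
    unfolding A_def restrict_PiE_iff by (simp only: Ball_def lessThan_iff singleton_iff)
  then have "{\<omega> \<in> space M. \<forall>k<j. Y k \<omega> = w k} = ?f -` A \<inter> space M"
    by blast
  ultimately show "{\<omega> \<in> space M. \<forall>k<j. Y k \<omega> = w k} \<in> sets (past_algebra M Y j)"
    unfolding sets_eq by (intro CollectI exI conjI)
qed

text \<open>The defining property of conditional expectation: integrating the almost sure identity
  over a past event \<open>A\<close> turns it into a product formula.\<close>

lemma prob_next_value:
  assumes Y: "\<And>k. Y k \<in> measurable M (count_space UNIV)"
    and cond: "AE \<omega> in M. real_cond_exp M (past_algebra M Y j)
      (indicator {\<omega>\<in>space M. Y j \<omega> = i}) \<omega> = q"
    and A: "A \<in> sets (past_algebra M Y j)"
  shows "prob (A \<inter> {\<omega>\<in>space M. Y j \<omega> = i}) = q * prob A"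
proof -
  let ?F = "past_algebra M Y j" and ?B = "{\<omega>\<in>space M. Y j \<omega> = i}"
  interpret F: finite_measure_subalgebra M ?F
    by unfold_locales (rule subalgebra_past_algebra[OF Y])
  have AM: "A \<in> sets M"
    using A F.subalg by (auto simp: subalgebra_def)
  have BM: "?B \<in> sets M"
    using Y[of j] by measurable
  have int: "integrable M (indicator ?B :: _ \<Rightarrow> real)"
    using BM by (simp add: integrable_indicator_iff less_top[symmetric])
  have "prob (A \<inter> ?B) = (\<integral>\<omega>\<in>A. indicator ?B \<omega> \<partial>M)"
    using AM BM by (simp add: set_lebesgue_integral_def indicator_inter_arith[symmetric] Int_absorb1)
  also have "\<dots> = (\<integral>\<omega>\<in>A. real_cond_exp M ?F (indicator ?B) \<omega> \<partial>M)"
    by (rule F.real_cond_exp_intA[OF int A])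
  also have "\<dots> = (\<integral>\<omega>\<in>A. q \<partial>M)"
    unfolding set_lebesgue_integral_def
    by (intro integral_cong_AE) (use cond AM in \<open>auto elim!: eventually_mono\<close>)
  also have "\<dots> = q * prob A"
    using AM by (simp add: set_lebesgue_integral_def)
  finally show ?thesis .
qed

text \<open>Each letter after the first multiplies the probability by its \<open>q\<close>, the
  shorter prefix being the past event. The conditional law starts at index 1, so the initial letter
  is only estimated by 1, whence the inequality.\<close>

lemma prob_prefix_le:
  assumes Y: "\<And>k. Y k \<in> measurable M (count_space UNIV)"
    and cond: "\<And>j i. j \<ge> 1 \<Longrightarrow> i \<in> P \<Longrightarrow> AE \<omega> in M. real_cond_exp M (past_algebra M Y j)
      (indicator {\<omega>\<in>space M. Y j \<omega> = i}) \<omega> = q i"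
    and q: "\<And>i. i \<in> P \<Longrightarrow> q i \<ge> 0"
    and w: "\<And>j. j < n \<Longrightarrow> w j \<in> P"
  shows "prob {\<omega> \<in> space M. \<forall>k<n. Y k \<omega> = w k} \<le> (\<Prod>j<n. if j = 0 then 1 else q (w j))"
  using w
proof (induction n)
  case (Suc n)
  let ?A = "{\<omega> \<in> space M. \<forall>k<n. Y k \<omega> = w k}" and ?B = "{\<omega> \<in> space M. Y n \<omega> = w n}"
  have eq: "{\<omega> \<in> space M. \<forall>k<Suc n. Y k \<omega> = w k} = ?A \<inter> ?B"
    by (auto simp: less_Suc_eq)
  show ?case
  proof (cases "n = 0")
    case True
    then show ?thesis by simp
  next
    case False
    have "prob (?A \<inter> ?B) = q (w n) * prob ?A"
      using False Suc.prems by (intro prob_next_value Y cond prefix_in_past_algebra) auto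
    also have "\<dots> \<le> q (w n) * (\<Prod>j<n. if j = 0 then 1 else q (w j))"
      using Suc by (intro mult_left_mono q) auto
    finally show ?thesis unfolding eq using False by (simp add: mult.commute)
  qed
qed simp

text \<open>Laplace transform of the exponential law. The density of rate \<open>r\<close> times
  \<open>exp (- a * x)\<close> is \<open>r / (a + r)\<close> times the density of rate
  \<open>a + r\<close>, whose total mass is 1. Here \<open>a\<close> may be negative as long as
  \<open>a + r > 0\<close>.\<close>

lemma nn_integral_exp_exponential:
  assumes X: "distributed M lborel X (exponential_density r)" and r: "r > 0" and a: "a + r > 0"
  shows "(\<integral>\<^sup>+\<omega>. ennreal (exp (- a * X \<omega>)) \<partial>M) = ennreal (1 / (1 + a / r))"
proof -
  interpret E: prob_space "density lborel (exponential_density (a + r))"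
    using a by (rule prob_space_exponential_density)
  have one: "(\<integral>\<^sup>+x. ennreal (exponential_density (a + r) x) \<partial>lborel) = 1"
    using E.emeasure_space_1 by (simp add: emeasure_density)
  have "(\<integral>\<^sup>+\<omega>. ennreal (exp (- a * X \<omega>)) \<partial>M) =
      (\<integral>\<^sup>+x. ennreal (exponential_density r x) * ennreal (exp (- a * x)) \<partial>lborel)"
    using distributed_nn_integral[OF X, of "\<lambda>x. ennreal (exp (- a * x))"] by simp
  also have "\<dots> = (\<integral>\<^sup>+x. ennreal (r / (a + r)) * ennreal (exponential_density (a + r) x) \<partial>lborel)"
  proof (intro nn_integral_cong)
    fix x :: real
    have "exp (- x * r) * exp (- a * x) = exp (- x * (a + r))"
      by (simp add: exp_add[symmetric] algebra_simps)
    then have "exponential_density r x * exp (- a * x) = r / (a + r) * exponential_density (a + r) x"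
      using a by (simp add: exponential_density_def)
    then show "ennreal (exponential_density r x) * ennreal (exp (- a * x)) =
        ennreal (r / (a + r)) * ennreal (exponential_density (a + r) x)"
      using r a by (simp add: ennreal_mult[symmetric] exponential_density_nonneg)
  qed
  also have "\<dots> = ennreal (r / (a + r))"
    by (simp add: nn_integral_cmult one)
  also have "r / (a + r) = 1 / (1 + a / r)"
    using r a by (simp add: field_simps)
  finally show ?thesis .
qed

lemma indep_var_nn_integral:
  fixes X1 X2 :: "'a \<Rightarrow> ennreal"
  assumes "indep_var borel X1 borel X2"
  shows "(\<integral>\<^sup>+\<omega>. X1 \<omega> * X2 \<omega> \<partial>M) = (\<integral>\<^sup>+\<omega>. X1 \<omega> \<partial>M) * (\<integral>\<^sup>+\<omega>. X2 \<omega> \<partial>M)"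
proof -
  have borel: "(\<lambda>_. borel) = case_bool borel borel"
    by (auto simp: fun_eq_iff split: bool.split)
  have "(\<integral>\<^sup>+\<omega>. (\<Prod>i\<in>UNIV. case_bool X1 X2 i \<omega>) \<partial>M) = (\<Prod>i\<in>UNIV. \<integral>\<^sup>+\<omega>. case_bool X1 X2 i \<omega> \<partial>M)"
    using assms unfolding indep_var_def borel[symmetric] by (intro indep_vars_nn_integral) auto
  then show ?thesis by (simp add: UNIV_bool mult.commute)
qed

text \<open>Since \<open>indep_var\<close> requires both variables to have the same type, \<open>class_EH\<close> implicitly coerces
  the embedded signal to real numbers.\<close>

context
  fixes S :: "nat \<Rightarrow> 'a \<Rightarrow> real" and Y :: "nat \<Rightarrow> 'a \<Rightarrow> nat" and rate :: real
  assumes S_indep: "indep_vars (\<lambda>_. borel) S {1..}"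
    and S_dist: "\<And>i. i \<ge> 1 \<Longrightarrow> distributed M lborel (S i) (exponential_density rate)"
    and rate: "rate > 0"
    and SY_indep: "indep_var (Pi\<^sub>M {1..} (\<lambda>_. borel)) (\<lambda>\<omega>. \<lambda>i\<in>{1..}. S i \<omega>)
      (Pi\<^sub>M UNIV (\<lambda>_. count_space UNIV)) (\<lambda>\<omega> j. real (Y j \<omega>))"
begin

text \<open>Measurability is read off from the independence hypothesis for the real-valued copy; the
  floor undoes the coercion.\<close>

lemma measurable_embedded: "Y j \<in> measurable M (count_space UNIV)"
proof -
  have "(\<lambda>\<omega>. real (Y j \<omega>)) \<in> measurable M (count_space UNIV)"
    using measurable_compose[OF indep_var_rv2[OF SY_indep] measurable_component_singleton[of j]] by simp
  then have "(\<lambda>\<omega>. nat \<lfloor>real (Y j \<omega>)\<rfloor>) \<in> measurable M (count_space UNIV)"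
    by (rule measurable_compose) simp
  then show ?thesis by simp
qed

lemma prefix_sets: "{\<omega> \<in> space M. \<forall>k<n. Y k \<omega> = w k} \<in> sets M"
proof -
  have "sets (past_algebra M Y n) \<subseteq> sets M"
    using subalgebra_past_algebra[of Y n, OF measurable_embedded] by (simp only: subalgebra_def)
  then show ?thesis
    using prefix_in_past_algebra[of Y n w, OF measurable_embedded] by (rule subsetD)
qed

lemma measurable_holding: "S (Suc j) \<in> borel_measurable M"
  using distributed_measurable[OF S_dist[of "Suc j"]] by simp

text \<open>For a fixed word \<open>w\<close> the product depends on the holding times alone.
  Independence of the two sequences splits off the probability of the word, independence of the
  holding times factorises the rest, and each factor is a Laplace transform.\<close>

lemma nn_integral_word:
  assumes c: "c > 0" and a: "\<And>j. j < n \<Longrightarrow> a (w j) + rate > 0"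
  shows "(\<integral>\<^sup>+\<omega>. (\<Prod>j<n. ennreal (c * exp (- a (w j) * S (Suc j) \<omega>))) *
      indicator {\<omega> \<in> space M. \<forall>k<n. Y k \<omega> = w k} \<omega> \<partial>M) =
    (\<Prod>j<n. ennreal (c / (1 + a (w j) / rate))) * ennreal (prob {\<omega> \<in> space M. \<forall>k<n. Y k \<omega> = w k})"
proof -
  let ?A = "{\<omega> \<in> space M. \<forall>k<n. Y k \<omega> = w k}"
  let ?NS = "Pi\<^sub>M {1..} (\<lambda>_. borel) :: (nat \<Rightarrow> real) measure"
  let ?NY = "Pi\<^sub>M UNIV (\<lambda>_. count_space UNIV) :: (nat \<Rightarrow> real) measure"
  define h1 where "h1 = (\<lambda>s :: nat \<Rightarrow> real. \<Prod>j<n. ennreal (c * exp (- a (w j) * s (Suc j))))"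
  define h2 where "h2 = (\<lambda>y. indicator {y \<in> space ?NY. \<forall>k<n. y k = real (w k)} y :: ennreal)"
  have comp: "(\<lambda>s. s (Suc j)) \<in> borel_measurable ?NS" for j
    by (rule measurable_component_singleton) simp
  have h1: "h1 \<in> borel_measurable ?NS"
    unfolding h1_def using comp by measurable
  have "{y \<in> space ?NY. \<forall>k<n. y k = real (w k)} \<in> sets ?NY"
    by measurable
  then have h2: "h2 \<in> borel_measurable ?NY"
    unfolding h2_def by (rule borel_measurable_indicator)
  have A: "?A \<in> sets M"
    by (rule prefix_sets)
  have indep: "indep_var borel (h1 \<circ> (\<lambda>\<omega>. \<lambda>i\<in>{1..}. S i \<omega>)) borel (h2 \<circ> (\<lambda>\<omega> j. real (Y j \<omega>)))"
    by (rule indep_var_compose[OF SY_indep h1 h2])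
  have "(\<integral>\<^sup>+\<omega>. (\<Prod>j<n. ennreal (c * exp (- a (w j) * S (Suc j) \<omega>))) * indicator ?A \<omega> \<partial>M) =
      (\<integral>\<^sup>+\<omega>. (h1 \<circ> (\<lambda>\<omega>. \<lambda>i\<in>{1..}. S i \<omega>)) \<omega> * (h2 \<circ> (\<lambda>\<omega> j. real (Y j \<omega>))) \<omega> \<partial>M)"
    by (intro nn_integral_cong) (simp add: h1_def h2_def space_PiM indicator_def)
  also have "\<dots> = (\<integral>\<^sup>+\<omega>. (h1 \<circ> (\<lambda>\<omega>. \<lambda>i\<in>{1..}. S i \<omega>)) \<omega> \<partial>M) * (\<integral>\<^sup>+\<omega>. (h2 \<circ> (\<lambda>\<omega> j. real (Y j \<omega>))) \<omega> \<partial>M)"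
    by (rule indep_var_nn_integral[OF indep])
  also have "(\<integral>\<^sup>+\<omega>. (h2 \<circ> (\<lambda>\<omega> j. real (Y j \<omega>))) \<omega> \<partial>M) = (\<integral>\<^sup>+\<omega>. indicator ?A \<omega> \<partial>M)"
    by (intro nn_integral_cong) (simp add: h2_def space_PiM indicator_def)
  also have "\<dots> = ennreal (prob ?A)"
    by (simp only: nn_integral_indicator[OF A] emeasure_eq_measure)
  \<comment> \<open>Holding times are numbered from 1: the letter \<open>w (j - 1)\<close> is active
    during the holding time \<open>S j\<close>.\<close>
  also have "(\<integral>\<^sup>+\<omega>. (h1 \<circ> (\<lambda>\<omega>. \<lambda>i\<in>{1..}. S i \<omega>)) \<omega> \<partial>M) =
      (\<integral>\<^sup>+\<omega>. (\<Prod>j\<in>{1..n}. ennreal (c * exp (- a (w (j - 1)) * S j \<omega>))) \<partial>M)"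
  proof (rule nn_integral_cong)
    fix \<omega>
    have "(\<Prod>j\<in>{1..n}. ennreal (c * exp (- a (w (j - 1)) * S j \<omega>))) =
        (\<Prod>j<n. ennreal (c * exp (- a (w j) * S (Suc j) \<omega>)))"
      by (simp only: One_nat_def prod.atLeast1_atMost_eq diff_Suc_Suc diff_zero)
    then show "(h1 \<circ> (\<lambda>\<omega>. \<lambda>i\<in>{1..}. S i \<omega>)) \<omega> =
        (\<Prod>j\<in>{1..n}. ennreal (c * exp (- a (w (j - 1)) * S j \<omega>)))"
      by (simp add: h1_def)
  qed
  also have "\<dots> = (\<Prod>j\<in>{1..n}. \<integral>\<^sup>+\<omega>. ennreal (c * exp (- a (w (j - 1)) * S j \<omega>)) \<partial>M)"
  proof (rule indep_vars_nn_integral)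
    have "indep_vars (\<lambda>_. borel) S {1..n}"
      by (rule indep_vars_subset[OF S_indep]) auto
    then show "indep_vars (\<lambda>_. borel) (\<lambda>j \<omega>. ennreal (c * exp (- a (w (j - 1)) * S j \<omega>))) {1..n}"
      by (rule indep_vars_compose2) measurable
  qed auto
  also have "\<dots> = (\<Prod>j<n. \<integral>\<^sup>+\<omega>. ennreal (c * exp (- a (w j) * S (Suc j) \<omega>)) \<partial>M)"
    by (simp add: prod.atLeast1_atMost_eq)
  also have "\<dots> = (\<Prod>j<n. ennreal (c / (1 + a (w j) / rate)))"
  proof (rule prod.cong[OF refl])
    fix j assume "j \<in> {..<n}"
    then have aj: "a (w j) + rate > 0" using a by simp
    then have pos: "1 + a (w j) / rate > 0" using rate by (simp add: field_simps)
    have "(\<integral>\<^sup>+\<omega>. ennreal (c * exp (- a (w j) * S (Suc j) \<omega>)) \<partial>M) =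
        (\<integral>\<^sup>+\<omega>. ennreal c * ennreal (exp (- a (w j) * S (Suc j) \<omega>)) \<partial>M)"
      using c by (simp add: ennreal_mult)
    also have "\<dots> = ennreal c * (\<integral>\<^sup>+\<omega>. ennreal (exp (- a (w j) * S (Suc j) \<omega>)) \<partial>M)"
      by (rule nn_integral_cmult) (use measurable_holding[of j] in measurable)
    also have "\<dots> = ennreal c * ennreal (1 / (1 + a (w j) / rate))"
      using S_dist[of "Suc j"] rate aj by (subst nn_integral_exp_exponential) auto
    also have "\<dots> = ennreal (c / (1 + a (w j) / rate))"
      using c pos by (simp add: ennreal_mult[symmetric])
    finally show "(\<integral>\<^sup>+\<omega>. ennreal (c * exp (- a (w j) * S (Suc j) \<omega>)) \<partial>M) =
        ennreal (c / (1 + a (w j) / rate))" .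
  qed
  finally show ?thesis .
qed

text \<open>Almost every sample follows one of the finitely many words over \<open>P\<close>, so the
  integrand is dominated by a sum over words. By distributivity the sum over all words factorises:
  the initial letter yields the sum in front, the other \<open>n\<close> letters yield the
  power.\<close>

lemma nn_integral_exp_product_le:
  fixes P :: "nat set" and a q :: "nat \<Rightarrow> real"
  assumes fin: "finite P" and Y_in: "AE \<omega> in M. \<forall>j. Y j \<omega> \<in> P"
    and cond: "\<And>j i. j \<ge> 1 \<Longrightarrow> i \<in> P \<Longrightarrow> AE \<omega> in M. real_cond_exp M (past_algebra M Y j)
      (indicator {\<omega>\<in>space M. Y j \<omega> = i}) \<omega> = q i"
    and q: "\<And>i. i \<in> P \<Longrightarrow> q i \<ge> 0"
    and c: "c > 0" and a: "\<And>i. i \<in> P \<Longrightarrow> a i + rate > 0"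
  shows "(\<integral>\<^sup>+\<omega>. ennreal (\<Prod>j<Suc n. c * exp (- a (Y j \<omega>) * S (Suc j) \<omega>)) \<partial>M) \<le>
    ennreal ((\<Sum>i\<in>P. c / (1 + a i / rate)) * (\<Sum>i\<in>P. c * q i / (1 + a i / rate)) ^ n)"
proof -
  define m where "m = (\<lambda>i. c / (1 + a i / rate))"
  define p where "p = (\<lambda>j i. if j = (0::nat) then 1 else q i)"
  define W where "W = PiE {..<Suc n} (\<lambda>_. P)"
  define A where "A = (\<lambda>w. {\<omega> \<in> space M. \<forall>k<Suc n. Y k \<omega> = w k})"
  define X where "X = (\<lambda>w \<omega>. \<Prod>j<Suc n. ennreal (c * exp (- a (w j) * S (Suc j) \<omega>)))"
  have m: "m i \<ge> 0" if "i \<in> P" for i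
  proof -
    have "1 + a i / rate > 0" using a[OF that] rate by (simp add: field_simps)
    then show ?thesis using c by (simp add: m_def)
  qed
  have finW: "finite W" unfolding W_def using fin by (intro finite_PiE) auto
  have W: "w j \<in> P" if "w \<in> W" "j < Suc n" for w j
    using that by (auto simp: W_def PiE_iff)
  have A_sets: "A w \<in> sets M" for w
    unfolding A_def by (rule prefix_sets)
  have X_meas: "X w \<in> borel_measurable M" for w
    unfolding X_def using measurable_holding by measurable
  have "(\<integral>\<^sup>+\<omega>. ennreal (\<Prod>j<Suc n. c * exp (- a (Y j \<omega>) * S (Suc j) \<omega>)) \<partial>M) \<le>
      (\<integral>\<^sup>+\<omega>. (\<Sum>w\<in>W. X w \<omega> * indicator (A w) \<omega>) \<partial>M)"
  proof (rule nn_integral_mono_AE)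
    show "AE \<omega> in M. ennreal (\<Prod>j<Suc n. c * exp (- a (Y j \<omega>) * S (Suc j) \<omega>)) \<le>
        (\<Sum>w\<in>W. X w \<omega> * indicator (A w) \<omega>)"
      using AE_space Y_in
    proof eventually_elim
      fix \<omega> assume \<omega>: "\<omega> \<in> space M" "\<forall>j. Y j \<omega> \<in> P"
      define w where "w = (\<lambda>j\<in>{..<Suc n}. Y j \<omega>)"
      have wW: "w \<in> W" using \<omega> by (auto simp: w_def W_def)
      have "\<omega> \<in> A w" using \<omega> by (simp add: A_def w_def)
      have "ennreal (\<Prod>j<Suc n. c * exp (- a (Y j \<omega>) * S (Suc j) \<omega>)) = X w \<omega>"
        unfolding X_def using c by (subst prod_ennreal[symmetric]) (auto simp: w_def intro!: prod.cong)
      also have "\<dots> = X w \<omega> * indicator (A w) \<omega>"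
        using \<open>\<omega> \<in> A w\<close> by simp
      also have "\<dots> \<le> (\<Sum>w\<in>W. X w \<omega> * indicator (A w) \<omega>)"
        by (rule member_le_sum[OF wW _ finW]) simp
      finally show "ennreal (\<Prod>j<Suc n. c * exp (- a (Y j \<omega>) * S (Suc j) \<omega>)) \<le>
        (\<Sum>w\<in>W. X w \<omega> * indicator (A w) \<omega>)" .
    qed
  qed
  also have "\<dots> = (\<Sum>w\<in>W. \<integral>\<^sup>+\<omega>. X w \<omega> * indicator (A w) \<omega> \<partial>M)"
    using A_sets X_meas by (intro nn_integral_sum) auto
  also have "\<dots> \<le> (\<Sum>w\<in>W. ennreal (\<Prod>j<Suc n. p j (w j) * m (w j)))"
  proof (rule sum_mono)
    fix w assume w: "w \<in> W"
    have "(\<integral>\<^sup>+\<omega>. X w \<omega> * indicator (A w) \<omega> \<partial>M) = (\<Prod>j<Suc n. ennreal (m (w j))) * ennreal (prob (A w))"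
      unfolding X_def A_def m_def using a W[OF w] by (intro nn_integral_word c) auto
    also have "(\<Prod>j<Suc n. ennreal (m (w j))) = ennreal (\<Prod>j<Suc n. m (w j))"
      using m W[OF w] by (intro prod_ennreal) auto
    also have "\<dots> * ennreal (prob (A w)) = ennreal ((\<Prod>j<Suc n. m (w j)) * prob (A w))"
      using m W[OF w] by (intro ennreal_mult[symmetric] prod_nonneg measure_nonneg) auto
    also have "\<dots> \<le> ennreal ((\<Prod>j<Suc n. m (w j)) * (\<Prod>j<Suc n. p j (w j)))"
      unfolding A_def p_def using m W[OF w]
      by (intro ennreal_leI mult_left_mono prob_prefix_le[OF measurable_embedded cond q] prod_nonneg) auto
    also have "(\<Prod>j<Suc n. m (w j)) * (\<Prod>j<Suc n. p j (w j)) = (\<Prod>j<Suc n. p j (w j) * m (w j))"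
      by (simp only: prod.distrib mult.commute)
    finally show "(\<integral>\<^sup>+\<omega>. X w \<omega> * indicator (A w) \<omega> \<partial>M) \<le> ennreal (\<Prod>j<Suc n. p j (w j) * m (w j))" .
  qed
  also have "\<dots> = ennreal (\<Sum>w\<in>W. \<Prod>j<Suc n. p j (w j) * m (w j))"
    using m q W by (intro sum_ennreal prod_nonneg) (auto simp: p_def)
  also have "(\<Sum>w\<in>W. \<Prod>j<Suc n. p j (w j) * m (w j)) = (\<Prod>j<Suc n. \<Sum>i\<in>P. p j i * m i)"
    unfolding W_def using fin by (intro prod_sum_PiE[symmetric]) auto
  also have "\<dots> = (\<Sum>i\<in>P. m i) * (\<Sum>i\<in>P. q i * m i) ^ n"
    by (simp only: prod.lessThan_Suc_shift) (simp add: p_def)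
  finally show ?thesis by (simp add: m_def mult.commute)
qed

text \<open>The constants are kept general for two uses: \<open>c = \<mu>\<close>,
  \<open>a = l\<close> for the Lyapunov functions, and \<open>c = 1\<close>, \<open>a = 1\<close>
  for the switching instants.\<close>

lemma AE_exp_product_tendsto_0:
  fixes P :: "nat set" and a q :: "nat \<Rightarrow> real"
  assumes fin: "finite P" and Y_in: "AE \<omega> in M. \<forall>j. Y j \<omega> \<in> P"
    and cond: "\<And>j i. j \<ge> 1 \<Longrightarrow> i \<in> P \<Longrightarrow> AE \<omega> in M. real_cond_exp M (past_algebra M Y j)
      (indicator {\<omega>\<in>space M. Y j \<omega> = i}) \<omega> = q i"
    and q: "\<And>i. i \<in> P \<Longrightarrow> q i \<ge> 0"
    and c: "c > 0" and a: "\<And>i. i \<in> P \<Longrightarrow> a i + rate > 0"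
    and contr: "(\<Sum>i\<in>P. c * q i / (1 + a i / rate)) < 1"
  shows "AE \<omega> in M. (\<lambda>n. \<Prod>j<n. c * exp (- a (Y j \<omega>) * S (Suc j) \<omega>)) \<longlonglongrightarrow> 0"
proof -
  define Z where "Z = (\<lambda>n \<omega>. \<Prod>j<n. c * exp (- a (Y j \<omega>) * S (Suc j) \<omega>))"
  define \<rho> where "\<rho> = (\<Sum>i\<in>P. c * q i / (1 + a i / rate))"
  define C where "C = (\<Sum>i\<in>P. c / (1 + a i / rate))"
  have pos: "1 + a i / rate > 0" if "i \<in> P" for i
    using a[OF that] rate by (simp add: field_simps)
  have \<rho>: "0 \<le> \<rho>" "\<rho> < 1"
    using contr c q pos by (auto simp: \<rho>_def intro!: sum_nonneg divide_nonneg_pos)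
  have C: "0 \<le> C"
    using c pos by (auto simp: C_def intro!: sum_nonneg divide_nonneg_pos)
  have Z_nonneg: "Z n \<omega> \<ge> 0" for n \<omega>
    unfolding Z_def using c by (intro prod_nonneg) auto
  have aY: "(\<lambda>\<omega>. a (Y j \<omega>)) \<in> borel_measurable M" for j
    by (rule measurable_compose[OF measurable_embedded]) simp
  have Z_meas: "Z n \<in> borel_measurable M" for n
    unfolding Z_def using aY measurable_holding by measurable
  \<comment> \<open>Nonnegativity permits the exchange of sum and integral; the shift by one matches
    the moment bound, which is stated for nonempty products.\<close>
  have "(\<integral>\<^sup>+\<omega>. (\<Sum>n. ennreal (Z (Suc n) \<omega>)) \<partial>M) = (\<Sum>n. \<integral>\<^sup>+\<omega>. ennreal (Z (Suc n) \<omega>) \<partial>M)"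
    using Z_meas by (intro nn_integral_suminf) auto
  also have "\<dots> \<le> (\<Sum>n. ennreal (C * \<rho> ^ n))"
    unfolding Z_def C_def \<rho>_def
    by (intro suminf_le summableI nn_integral_exp_product_le[OF fin Y_in cond q c a])
  also have "\<dots> = ennreal (\<Sum>n. C * \<rho> ^ n)"
    using \<rho> C by (intro suminf_ennreal2) (auto intro!: summable_mult summable_geometric)
  finally have "(\<integral>\<^sup>+\<omega>. (\<Sum>n. ennreal (Z (Suc n) \<omega>)) \<partial>M) \<noteq> \<infinity>"
    by (auto simp: top_unique)
  then have "AE \<omega> in M. (\<Sum>n. ennreal (Z (Suc n) \<omega>)) \<noteq> \<infinity>"
    using Z_meas by (intro nn_integral_PInf_AE) auto
  then have "AE \<omega> in M. (\<lambda>n. Z n \<omega>) \<longlonglongrightarrow> 0"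
  proof eventually_elim
    fix \<omega> assume "(\<Sum>n. ennreal (Z (Suc n) \<omega>)) \<noteq> \<infinity>"
    then have "summable (\<lambda>n. Z (Suc n) \<omega>)"
      using Z_nonneg by (intro summable_suminf_not_top) auto
    then have "(\<lambda>n. Z (Suc n) \<omega>) \<longlonglongrightarrow> 0"
      by (rule summable_LIMSEQ_zero)
    then show "(\<lambda>n. Z n \<omega>) \<longlonglongrightarrow> 0"
      by (rule LIMSEQ_imp_Suc)
  qed
  then show ?thesis by (simp add: Z_def)
qed

text \<open>With the whole space as past event, \<open>q i\<close> is the probability that the first
  switch leads to \<open>i\<close>, and these events are disjoint. This makes the computation with
  rates 1 contract.\<close>

lemma sum_transition_le_1:
  fixes P :: "nat set" and q :: "nat \<Rightarrow> real"
  assumes fin: "finite P"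
    and cond: "\<And>i. i \<in> P \<Longrightarrow> AE \<omega> in M. real_cond_exp M (past_algebra M Y 1)
      (indicator {\<omega>\<in>space M. Y 1 \<omega> = i}) \<omega> = q i"
  shows "(\<Sum>i\<in>P. q i) \<le> 1"
proof -
  have space: "space M \<in> sets (past_algebra M Y 1)"
    using subalgebra_past_algebra[of Y 1] measurable_embedded sets.top[of "past_algebra M Y 1"]
    by (simp add: subalgebra_def)
  have ev: "{\<omega>\<in>space M. Y 1 \<omega> = i} \<in> sets M" for i
    using measurable_embedded[of 1] by measurable
  have "q i = prob {\<omega>\<in>space M. Y 1 \<omega> = i}" if "i \<in> P" for i
    using prob_next_value[OF measurable_embedded cond[OF that] space]
    by (simp add: prob_space Int_absorb1)
  then have "(\<Sum>i\<in>P. q i) = (\<Sum>i\<in>P. prob {\<omega>\<in>space M. Y 1 \<omega> = i})"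
    by simp
  also have "\<dots> = prob (\<Union>i\<in>P. {\<omega>\<in>space M. Y 1 \<omega> = i})"
    using ev fin by (intro finite_measure_finite_Union[symmetric]) (auto simp: disjoint_family_on_def)
  also have "\<dots> \<le> 1" by (rule prob_le_1)
  finally show ?thesis .
qed

end

end

section \<open>Almost sure stability\<close>

text \<open>\<open>gradient\<close> is a definite description, so a representing vector has to be
  exhibited and shown unique; it is built from the values of the derivative on
  \<open>Basis\<close>.\<close>

lemma gradient_has_derivative:
  fixes W :: "'a::euclidean_space \<Rightarrow> real"
  assumes "twice_continuously_differentiable W"
  shows "(W has_derivative (\<lambda>h. gradient W x \<bullet> h)) (at x)"
proof -
  obtain W' :: "'a \<Rightarrow>\<^sub>L real" where W': "(W has_derivative blinfun_apply W') (at x)"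
    using assms unfolding twice_continuously_differentiable_def by blast
  define D where "D = (\<Sum>b\<in>Basis. W' b *\<^sub>R b)"
  have "W' h = h \<bullet> D" for h
  proof -
    have "W' h = W' (\<Sum>b\<in>Basis. (h \<bullet> b) *\<^sub>R b)"
      by (simp add: euclidean_representation)
    also have "\<dots> = h \<bullet> D"
      by (simp add: D_def blinfun.sum_right blinfun.scaleR_right inner_sum_right mult.commute)
    finally show ?thesis .
  qed
  then have "blinfun_apply W' = (\<lambda>h. h \<bullet> D)" by (rule ext)
  with W' have D: "GDERIV W x :> D" by (simp add: gderiv_def)
  have "E = D" if "GDERIV W x :> E" for E
  proof -
    have "(\<lambda>h. h \<bullet> E) = (\<lambda>h. h \<bullet> D)"
      using that D unfolding gderiv_def by (rule has_derivative_unique)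
    then have "h \<bullet> E = h \<bullet> D" for h by meson
    then show ?thesis by (rule vector_eq_ldot[THEN iffD1, OF allI])
  qed
  with D have "gradient W x = D"
    unfolding gradient_def by (rule the_equality)
  with D show ?thesis by (simp add: gderiv_def inner_commute)
qed

text \<open>A supremum of strictly bounded norms is in general only weakly bounded; halving the
  tolerance restores the strict inequality.\<close>

lemma SUP_ereal_norm_less:
  assumes "\<And>t. t \<in> A \<Longrightarrow> norm (x t) < e / 2" and "e > 0"
  shows "(SUP t\<in>A. ereal (norm (x t))) < ereal e"
proof -
  have "(SUP t\<in>A. ereal (norm (x t))) \<le> ereal (e / 2)"
    using assms(1) by (intro SUP_least) (simp add: less_imp_le)
  also have "\<dots> < ereal e" using assms(2) by simp
  finally show ?thesis .
qed

lemma filterlim_at_top_if_exp_minus_tendsto_0: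
  fixes u :: "nat \<Rightarrow> real"
  assumes "(\<lambda>n. exp (- u n)) \<longlonglongrightarrow> 0"
  shows "filterlim u at_top sequentially"
  unfolding filterlim_at_top_dense
proof
  fix K :: real
  have "eventually (\<lambda>n. exp (- u n) < exp (- K)) sequentially"
    by (rule order_tendstoD(2)[OF assms]) simp
  then show "eventually (\<lambda>n. K < u n) sequentially" by (simp)
qed

text \<open>Measurability into \<open>count_space P\<close> places every value
  \<open>\<sigma> t \<omega>\<close> with \<open>t \<ge> 0\<close> in \<open>P\<close>, so
  evaluation at the random time \<open>\<tau> j \<omega>\<close> only requires that time to be
  nonnegative.\<close>

lemma EH_embedded_in:
  assumes sig: "switching_signal M P \<sigma>\<^sub>0 \<sigma> \<tau>"
  shows "AE \<omega> in M. \<forall>j. embedded_signal \<sigma> \<tau> j \<omega> \<in> P"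
proof -
  have meas: "\<sigma> t \<in> measurable M (count_space P)" if "t \<ge> 0" for t
    using sig that by (simp add: switching_signal_def)
  have "AE \<omega> in M. \<tau> 0 \<omega> = 0 \<and> (\<forall>i. \<tau> i \<omega> < \<tau> (Suc i) \<omega>)"
    using sig by (simp add: switching_signal_def)
  with AE_space show ?thesis
  proof eventually_elim
    fix \<omega> assume \<omega>: "\<omega> \<in> space M" and \<tau>: "\<tau> 0 \<omega> = 0 \<and> (\<forall>i. \<tau> i \<omega> < \<tau> (Suc i) \<omega>)"
    have "\<tau> j \<omega> \<ge> 0" for j
    proof (induction j)
      case (Suc j)
      moreover have "\<tau> j \<omega> < \<tau> (Suc j) \<omega>" using \<tau> by blast
      ultimately show ?case by linarith
    qed (use \<tau> in simp)
    then show "\<forall>j. embedded_signal \<sigma> \<tau> j \<omega> \<in> P"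
      using measurable_space[OF meas \<omega>] by (simp add: embedded_signal_def)
  qed
qed

lemma (in prob_space) EH_AE_decay:
  assumes sig: "switching_signal M P \<sigma>\<^sub>0 \<sigma> \<tau>" and EH: "class_EH M P \<sigma> \<tau> rate q"
    and fin: "finite P" and c: "c > 0" and a: "\<And>i. i \<in> P \<Longrightarrow> a i + rate > 0"
    and contr: "(\<Sum>i\<in>P. c * q i / (1 + a i / rate)) < 1"
  shows "AE \<omega> in M. (\<lambda>n. \<Prod>j<n. c * exp (- a (\<sigma> (\<tau> j \<omega>) \<omega>) * (\<tau> (Suc j) \<omega> - \<tau> j \<omega>))) \<longlonglongrightarrow> 0"
proof -
  note EH' = EH[unfolded class_EH_def Let_def]
  have "AE \<omega> in M. (\<lambda>n. \<Prod>j<n. c * exp (- a (embedded_signal \<sigma> \<tau> j \<omega>) * holding_time \<tau> (Suc j) \<omega>)) \<longlonglongrightarrow> 0"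
  proof (rule AE_exp_product_tendsto_0[OF _ _ _ _ fin _ _ _ c a contr])
    show "AE \<omega> in M. \<forall>j. embedded_signal \<sigma> \<tau> j \<omega> \<in> P"
      by (rule EH_embedded_in[OF sig])
  qed (use EH' in blast)+
  then show ?thesis by (simp add: embedded_signal_def holding_time_def)
qed

lemma (in prob_space) EH_AE_unbounded:
  assumes sig: "switching_signal M P \<sigma>\<^sub>0 \<sigma> \<tau>" and EH: "class_EH M P \<sigma> \<tau> rate q"
    and fin: "finite P"
  shows "AE \<omega> in M. filterlim (\<lambda>n. \<tau> n \<omega>) at_top sequentially"
proof -
  note EH' = EH[unfolded class_EH_def Let_def]
  have rate: "rate > 0" using EH' by blast
  have "(\<Sum>i\<in>P. q i) \<le> 1"
    by (rule sum_transition_le_1[OF _ _ _ _ fin, where Y = "embedded_signal \<sigma> \<tau>"]) (use EH' in blast)+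
  then have "(\<Sum>i\<in>P. q i) / (1 + 1 / rate) \<le> 1 / (1 + 1 / rate)"
    using rate by (intro divide_right_mono) auto
  also have "\<dots> < 1" using rate by (simp add: field_simps)
  finally have contr: "(\<Sum>i\<in>P. 1 * q i / (1 + 1 / rate)) < 1"
    by (simp add: sum_divide_distrib)
  have "AE \<omega> in M. (\<lambda>n. \<Prod>j<n. 1 * exp (- 1 * (\<tau> (Suc j) \<omega> - \<tau> j \<omega>))) \<longlonglongrightarrow> 0"
    using rate by (intro EH_AE_decay[OF sig EH fin _ _ contr]) auto
  moreover have "AE \<omega> in M. \<tau> 0 \<omega> = 0"
    using sig unfolding switching_signal_def by (auto elim: eventually_mono)
  ultimately show ?thesis
  proof eventually_elim
    fix \<omega>
    assume lim: "(\<lambda>n. \<Prod>j<n. 1 * exp (- 1 * (\<tau> (Suc j) \<omega> - \<tau> j \<omega>))) \<longlonglongrightarrow> 0" and 0: "\<tau> 0 \<omega> = 0"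
    \<comment> \<open>The exponents telescope, starting from
      \<open>\<tau> 0 \<omega> = 0\<close>.\<close>
    have "(\<Prod>j<n. 1 * exp (- 1 * (\<tau> (Suc j) \<omega> - \<tau> j \<omega>))) = exp (- \<tau> n \<omega>)" for n
      by (induction n) (simp_all add: 0 exp_add[symmetric])
    with lim show "filterlim (\<lambda>n. \<tau> n \<omega>) at_top sequentially"
      by (intro filterlim_at_top_if_exp_minus_tendsto_0) simp
  qed
qed

theorem theorem7p3:
  fixes M :: "'w measure"
    and N :: nat
    and f :: "nat \<Rightarrow> real ^ 'n \<Rightarrow> real ^ 'n"
    and g :: "nat \<Rightarrow> 'm::finite \<Rightarrow> real ^ 'n \<Rightarrow> real ^ 'n"
    and \<sigma>\<^sub>0 :: nat
    and \<sigma> :: "real \<Rightarrow> 'w \<Rightarrow> nat"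
    and \<tau> :: "nat \<Rightarrow> 'w \<Rightarrow> real"
    and rate :: real
    and q :: "nat \<Rightarrow> real"
    and V :: "nat \<Rightarrow> real ^ 'n \<Rightarrow> real"
    and \<alpha>\<^sub>1 \<alpha>\<^sub>2 :: "real \<Rightarrow> real"
    and \<mu> :: real
    and k :: "real ^ 'n \<Rightarrow> real ^ 'm"
    and l :: "nat \<Rightarrow> real"
  assumes "prob_space M" and "complete_measure M"
    and "\<And>i. i \<in> {1..N} \<Longrightarrow> twice_continuously_differentiable (f i)"
    and "\<And>i j. i \<in> {1..N} \<Longrightarrow> twice_continuously_differentiable (g i j)"
    and "\<And>i. i \<in> {1..N} \<Longrightarrow> f i 0 = 0"
    and "\<And>i j. i \<in> {1..N} \<Longrightarrow> g i j 0 = 0"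
    and "switching_signal M {1..N} \<sigma>\<^sub>0 \<sigma> \<tau>"
    and "class_EH M {1..N} \<sigma> \<tau> rate q"
    and "\<And>i. i \<in> {1..N} \<Longrightarrow> twice_continuously_differentiable (V i)"
    and "class_K_infinity \<alpha>\<^sub>1" and "class_K_infinity \<alpha>\<^sub>2" and "\<mu> > 1"
    and "\<And>i x. i \<in> {1..N} \<Longrightarrow> \<alpha>\<^sub>1 (norm x) \<le> V i x \<and> V i x \<le> \<alpha>\<^sub>2 (norm x)"
    and "\<And>i j x. i \<in> {1..N} \<Longrightarrow> j \<in> {1..N} \<Longrightarrow> V i x \<le> \<mu> * V j x"
    and "\<And>i. i \<in> {1..N} \<Longrightarrow> locally_Lipschitz (closed_loop_field f g k i)"
    and "\<And>i x. i \<in> {1..N} \<Longrightarrow> gradient (V i) x \<bullet> closed_loop_field f g k i x \<le> - l i * V i x"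
    and "\<And>i. i \<in> {1..N} \<Longrightarrow> l i + rate > 0"
    and "(\<Sum>i\<in>{1..N}. \<mu> * q i / (1 + l i / rate)) < 1"
  shows "globally_asymptotically_stable_as M (closed_loop_field f g k) \<sigma>"
proof -
  interpret prob_space M by (rule assms(1))
  note sig = assms(7) and EH = assms(8) and K1 = assms(10) and K2 = assms(11) and \<mu> = assms(12)
  let ?P = "{1..N}" and ?F = "closed_loop_field f g k"
  define V' where "V' = (\<lambda>i x h. gradient (V i) x \<bullet> h)"
  \<comment> \<open>The predicate constrains only the sample path of the signal, so one null set
    serves all initial states, radii and tolerances at once.\<close>
  define good where "good = (\<lambda>\<omega>.
    switched_lyapunov ?P (\<lambda>t. \<sigma> t \<omega>) (\<lambda>n. \<tau> n \<omega>) (\<lambda>n. \<sigma> (\<tau> n \<omega>) \<omega>) ?F V V' \<mu> l \<and>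
    switched_lyapunov.decay (\<lambda>n. \<tau> n \<omega>) (\<lambda>n. \<sigma> (\<tau> n \<omega>) \<omega>) \<mu> l \<longlonglongrightarrow> 0)"
  have V1: "\<alpha>\<^sub>1 (norm z) \<le> V i z" and V2: "V i z \<le> \<alpha>\<^sub>2 (norm z)" if "i \<in> ?P" for i z
    using assms(13)[OF that, of z] by auto
  have V_nonneg: "V i z \<ge> 0" if "i \<in> ?P" for i z
    using V1[OF that, of z] class_K_infinity_nonneg[OF K1, of "norm z"] by simp
  have decay: "AE \<omega> in M. (\<lambda>n. \<Prod>j<n. \<mu> * exp (- l (\<sigma> (\<tau> j \<omega>) \<omega>) * (\<tau> (Suc j) \<omega> - \<tau> j \<omega>))) \<longlonglongrightarrow> 0"
    using \<mu> by (intro EH_AE_decay[OF sig EH _ _ assms(17) assms(18)]) auto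
  have "AE \<omega> in M. \<tau> 0 \<omega> = 0 \<and> (\<forall>i. \<tau> i \<omega> < \<tau> (Suc i) \<omega>)"
    and "AE \<omega> in M. \<forall>i. \<forall>t\<in>{\<tau> i \<omega>..<\<tau> (Suc i) \<omega>}. \<sigma> t \<omega> = \<sigma> (\<tau> i \<omega>) \<omega>"
    using sig by (simp_all add: switching_signal_def)
  with decay EH_AE_unbounded[OF sig EH finite_atLeastAtMost] EH_embedded_in[OF sig]
  have good: "AE \<omega> in M. good \<omega>"
  proof eventually_elim
    case (elim \<omega>)
    have loc: "switched_lyapunov ?P (\<lambda>t. \<sigma> t \<omega>) (\<lambda>n. \<tau> n \<omega>) (\<lambda>n. \<sigma> (\<tau> n \<omega>) \<omega>) ?F V V' \<mu> l"
    proof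
      show "\<tau> 0 \<omega> = 0" "\<tau> n \<omega> < \<tau> (Suc n) \<omega>" for n using elim by auto
      show "filterlim (\<lambda>n. \<tau> n \<omega>) at_top sequentially" using elim by auto
      show "\<sigma> t \<omega> = \<sigma> (\<tau> n \<omega>) \<omega>" if "\<tau> n \<omega> \<le> t" "t < \<tau> (Suc n) \<omega>" for n t
        using elim that by auto
      show "\<sigma> (\<tau> n \<omega>) \<omega> \<in> ?P" for n
        using elim by (simp add: embedded_signal_def)
      show "continuous_on UNIV (?F i)" if "i \<in> ?P" for i
        by (rule locally_Lipschitz_continuous_on[OF assms(15)[OF that]])
      show "(V i has_derivative V' i z) (at z)" if "i \<in> ?P" for i z
        unfolding V'_def by (rule gradient_has_derivative[OF assms(9)[OF that]])
      show "V' i z (?F i z) \<le> - l i * V i z" if "i \<in> ?P" for i z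
        unfolding V'_def by (rule assms(16)[OF that])
      show "V i z \<ge> 0" if "i \<in> ?P" for i z by (rule V_nonneg[OF that])
      show "V i z \<le> \<mu> * V j z" if "i \<in> ?P" "j \<in> ?P" for i j z by (rule assms(14)[OF that])
      show "\<mu> > 1" by (rule \<mu>)
    qed
    have "switched_lyapunov.decay (\<lambda>n. \<tau> n \<omega>) (\<lambda>n. \<sigma> (\<tau> n \<omega>) \<omega>) \<mu> l =
        (\<lambda>n. \<Prod>j<n. \<mu> * exp (- l (\<sigma> (\<tau> j \<omega>) \<omega>) * (\<tau> (Suc j) \<omega> - \<tau> j \<omega>)))"
      by (rule ext) (rule switched_lyapunov.decay_def[OF loc])
    with loc show "good \<omega>"
      unfolding good_def using elim by (simp only: simp_thms)
  qed
  \<comment> \<open>Convergence of the decay products also bounds them, which is what existence and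
    stability use; attractivity uses the limit itself.\<close>
  have bounded: "\<exists>D. \<forall>n. u n \<le> D" if "u \<longlonglongrightarrow> 0" for u :: "nat \<Rightarrow> real"
    using convergent_imp_Bseq[OF convergentI[OF that]] by (auto simp: Bseq_def abs_le_iff)
  show ?thesis
    unfolding globally_asymptotically_stable_as_def
  proof (intro conjI)
    show "AE \<omega> in M. \<forall>x0. \<exists>x. caratheodory_solution ?F (\<lambda>t. \<sigma> t \<omega>) x0 x"
      using good
    proof (rule eventually_mono, intro allI)
      fix \<omega> x0 assume "good \<omega>"
      then interpret switched_lyapunov ?P "\<lambda>t. \<sigma> t \<omega>" "\<lambda>n. \<tau> n \<omega>" "\<lambda>n. \<sigma> (\<tau> n \<omega>) \<omega>" ?F V V' \<mu> l
        by (simp add: good_def)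
      obtain D where D: "\<And>n. decay n \<le> D" using bounded \<open>good \<omega>\<close> by (auto simp: good_def)
      show "\<exists>x. caratheodory_solution ?F (\<lambda>t. \<sigma> t \<omega>) x0 x"
        by (rule exists_caratheodory_solution[OF finite_atLeastAtMost assms(15) K1 V1 D])
    qed
  next
    show "AE \<omega> in M. \<forall>\<epsilon>>0. \<exists>\<delta>>0. \<forall>x0 x.
        caratheodory_solution ?F (\<lambda>t. \<sigma> t \<omega>) x0 x \<and> norm x0 < \<delta> \<longrightarrow>
        (SUP t\<in>{0..}. ereal (norm (x t))) < ereal \<epsilon>"
      using good
    proof (rule eventually_mono, intro allI impI)
      fix \<omega> and \<epsilon> :: real assume "good \<omega>" and \<epsilon>: "\<epsilon> > 0"
      then interpret switched_lyapunov ?P "\<lambda>t. \<sigma> t \<omega>" "\<lambda>n. \<tau> n \<omega>" "\<lambda>n. \<sigma> (\<tau> n \<omega>) \<omega>" ?F V V' \<mu> l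
        by (simp add: good_def)
      obtain D where D: "\<And>n. decay n \<le> D" using bounded \<open>good \<omega>\<close> by (auto simp: good_def)
      obtain d where d: "d > 0" "\<forall>x0 x. caratheodory_solution ?F (\<lambda>t. \<sigma> t \<omega>) x0 x \<and> norm x0 < d \<longrightarrow>
          (\<forall>t\<ge>0. norm (x t) < \<epsilon> / 2)"
        using stable_path[OF K1 K2 V1 V2 D half_gt_zero[OF \<epsilon>]] by blast
      show "\<exists>\<delta>>0. \<forall>x0 x. caratheodory_solution ?F (\<lambda>t. \<sigma> t \<omega>) x0 x \<and> norm x0 < \<delta> \<longrightarrow>
        (SUP t\<in>{0..}. ereal (norm (x t))) < ereal \<epsilon>"
        by (intro exI[of _ d] conjI d(1) allI impI SUP_ereal_norm_less \<epsilon> d(2)[rule_format]) auto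
    qed
  next
    show "AE \<omega> in M. \<forall>r>0. \<forall>\<epsilon>>0. \<exists>T\<ge>0. \<forall>x0 x.
        caratheodory_solution ?F (\<lambda>t. \<sigma> t \<omega>) x0 x \<and> norm x0 < r \<longrightarrow>
        (SUP t\<in>{T..}. ereal (norm (x t))) < ereal \<epsilon>"
      using good
    proof (rule eventually_mono, intro allI impI)
      fix \<omega> and r \<epsilon> :: real assume "good \<omega>" and \<epsilon>: "\<epsilon> > 0"
      then interpret switched_lyapunov ?P "\<lambda>t. \<sigma> t \<omega>" "\<lambda>n. \<tau> n \<omega>" "\<lambda>n. \<sigma> (\<tau> n \<omega>) \<omega>" ?F V V' \<mu> l
        by (simp add: good_def)
      have lim: "decay \<longlonglongrightarrow> 0" using \<open>good \<omega>\<close> by (simp add: good_def)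
      obtain T where T: "T \<ge> 0" "\<forall>x0 x. caratheodory_solution ?F (\<lambda>t. \<sigma> t \<omega>) x0 x \<and> norm x0 < r \<longrightarrow>
          (\<forall>t\<ge>T. norm (x t) < \<epsilon> / 2)"
        using attractive_path[OF K1 K2 V1 V2 lim half_gt_zero[OF \<epsilon>], of r] by blast
      show "\<exists>T\<ge>0. \<forall>x0 x. caratheodory_solution ?F (\<lambda>t. \<sigma> t \<omega>) x0 x \<and> norm x0 < r \<longrightarrow>
        (SUP t\<in>{T..}. ereal (norm (x t))) < ereal \<epsilon>"
        by (intro exI[of _ T] conjI T(1) allI impI SUP_ereal_norm_less \<epsilon> T(2)[rule_format]) auto
    qed
  qed
qed

end
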